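(* Let $\sigma\ge 0$ and let $V,\gamma,\varepsilon>0$ satisfy \[ \sqrt{\tfrac{1+\sigma}{\sigma}}<\frac{V+\gamma\varepsilon}{\sqrt{\sigma}}<\zeta_\sigma \quad\text{if } \sigma>0,\qquad 1<V+\gamma\varepsilon<\zeta_0\quad\text{if }\sigma=0. \] Then the system \[ -(V+\gamma\varepsilon)n'+(nu)'=0,\qquad -(V+\gamma\varepsilon)u'+uu'+\sigma\frac{n'}{n}=-\phi',\qquad \varepsilon\phi''=e^{\phi}-n, \] for unknown functions $(n,u,\phi)$ of $\xi\in\mathbb{R}$ (with $'=d/d\xi$), together with the far-field condition $n\to1$, $u\to0$, $\phi\to0$ as $|\xi|\to\infty$, admits a non-trivial smooth solution $(n,u,\phi)$, which is unique up to translation $\xi\mapsto\xi-\xi_c$. Moreover, after an appropriate translation, this solution satisfies: (i) $n(\xi)=n(-\xi)$, $u(\xi)=u(-\xi)$, $\phi(\xi)=\phi(-\xi)$ for all $\xi\in\mathbb{R}$; (ii) $n'(\xi),u'(\xi),\phi'(\xi)<0$ for all $\xi\in(0,\infty)$; (iii) $(n,u,\phi)$ attains its maximum values at $\xi=0$; and (iv) $n(\xi)>1$, $u(\xi)>0$, $\phi(\xi)>0$ for all $\xi\in\mathbb{R}$.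
   Context: For $\sigma>0$, $\zeta_\sigma$ denotes the unique root $z>1$ of $z^{\sigma}[\sigma(z-1)^2+1]=\exp(\tfrac{\sigma}{2}(z^2-1))$ on $(1,\infty)$ (one has $\zeta_\sigma>\sqrt{(1+\sigma)/\sigma}$, and the left side exceeds the right side for $z\in(1,\zeta_\sigma)$). $\zeta_0$ denotes the unique positive root of $z^2+1=\exp(z^2/2)$. This system is the traveling-wave reduction of the one-dimensional Euler–Poisson system $\partial_t n+\partial_x(nu)=0$, $\partial_t u+u\partial_x u+\sigma\partial_x n/n=-\partial_x\phi$, $\partial_x^2\phi=e^\phi-n$ in the variable $\xi=\varepsilon^{1/2}(x-(V+\gamma\varepsilon)t)$. *)

theory Defs
  imports "HOL-Analysis.Analysis"
begin

definition zeta :: "real \<Rightarrow> real" where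
  "zeta \<sigma> = (if \<sigma> = 0
     then (THE z. 0 < z \<and> z\<^sup>2 + 1 = exp (z\<^sup>2 / 2))
     else (THE z. 1 < z \<and> z powr \<sigma> * (\<sigma> * (z - 1)\<^sup>2 + 1) = exp (\<sigma> / 2 * (z\<^sup>2 - 1))))"

definition smooth_fun :: "(real \<Rightarrow> real) \<Rightarrow> bool" where
  "smooth_fun f \<longleftrightarrow> (\<forall>k x. ((deriv ^^ k) f) differentiable (at x))"

text \<open>Smooth solutions of the traveling-wave system with far-field conditions,
  with wave speed c = V + gamma*eps.\<close>
definition tw_solution ::
  "real \<Rightarrow> real \<Rightarrow> real \<Rightarrow> (real \<Rightarrow> real) \<Rightarrow> (real \<Rightarrow> real) \<Rightarrow> (real \<Rightarrow> real) \<Rightarrow> bool" where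
  "tw_solution \<sigma> c \<epsilon> n u \<phi> \<longleftrightarrow>
     smooth_fun n \<and> smooth_fun u \<and> smooth_fun \<phi> \<and>
     (\<forall>x. n x > 0) \<and>
     (\<forall>x. - c * deriv n x + deriv (\<lambda>y. n y * u y) x = 0) \<and>
     (\<forall>x. - c * deriv u x + u x * deriv u x + \<sigma> * deriv n x / n x = - deriv \<phi> x) \<and>
     (\<forall>x. \<epsilon> * deriv (deriv \<phi>) x = exp (\<phi> x) - n x) \<and>
     (n \<longlongrightarrow> 1) at_infinity \<and> (u \<longlongrightarrow> 0) at_infinity \<and> (\<phi> \<longlongrightarrow> 0) at_infinity"

definition nontrivial :: "(real \<Rightarrow> real) \<Rightarrow> (real \<Rightarrow> real) \<Rightarrow> (real \<Rightarrow> real) \<Rightarrow> bool" where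
  "nontrivial n u \<phi> \<longleftrightarrow> (\<exists>x. n x \<noteq> 1 \<or> u x \<noteq> 0 \<or> \<phi> x \<noteq> 0)"

end

theory Submission
  imports Defs
begin

text \<open>Writing \<open>v = 1/n\<close>, the conservation laws and the far-field condition express \<open>u\<close> and \<open>\<phi>\<close>
  through \<open>v\<close>, and Poisson's equation has a first integral \<open>\<epsilon> \<phi>'\<^sup>2 / 2 = E v\<close>. The lower bound on the
  speed makes \<open>v = 1\<close> a saddle; the upper bound says exactly that \<open>E\<close> is negative at the sonic value
  \<open>v\<^sub>s = sqrt \<sigma> / c\<close>, where \<open>\<phi>\<close> stops being a coordinate. Hence no solution reaches \<open>v\<^sub>s\<close>, and \<open>E\<close> has
  exactly one zero \<open>v\<^sub>0\<close> in \<open>(v\<^sub>s, 1)\<close>, which is the crest. Every nontrivial solution satisfies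
  \<open>v\<^sub>0 \<le> v \<le> 1\<close> and attains \<open>v\<^sub>0\<close> with \<open>\<phi>' = 0\<close>, so uniqueness is that of the initial value problem
  there. The homoclinic orbit itself is found by quadrature after the substitution
  \<open>v = v\<^sub>0 + s\<^sup>2\<close>.\<close>

section \<open>Smooth functions and uniqueness for second-order equations\<close>

text \<open>Dividing by \<open>\<Phi>'\<close> is what obstructs a reduction to \<open>v\<close>,
  and the far-field condition alone does not confine a given solution to one side of the zero
  \<open>v\<^sub>s\<close> of \<open>\<Phi>'\<close>. The first integral does, because its left side
  is a square. With \<open>z = c / sqrt \<sigma>\<close> the energy at \<open>v\<^sub>s\<close>
  equals \<open>exp (\<sigma> / 2 * (z\<^sup>2 - 1)) / z powr \<sigma> - (\<sigma> * (z - 1)\<^sup>2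
  + 1)\<close>, which is the origin of \<open>zeta\<close>. The integration constant needs an
  argument of its own, since nothing is assumed about the limit of \<phi>'. The energy has a simple
  zero at the crest and a zero of order at least two at \<open>v = 1\<close>. At the simple zero the
  first-order equation for \<open>v\<close> has a square-root singularity and admits the spurious
  constant solution; the signed root \<open>s\<close> of \<open>v - v\<^sub>0\<close> crosses the
  crest with nonzero speed instead. The higher zero makes the rest state unreachable in finite time,
  so the orbit is global. Quadrature alone yields one derivative; smoothness is recovered from the
  second-order system.\<close>

lemma smooth_fun_if_deriv_closed:
  assumes closed: "\<And>g x. g \<in> A \<Longrightarrow> g differentiable (at x)" "\<And>g. g \<in> A \<Longrightarrow> deriv g \<in> A"
    and "f \<in> A"
  shows "smooth_fun f"
proof -
  have "(deriv ^^ k) f \<in> A" for k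
    by (induction k) (auto intro: closed \<open>f \<in> A\<close>)
  then show ?thesis
    unfolding smooth_fun_def using closed(1) by blast
qed

text \<open>Polynomials in the generators. Once the derivative of every generator is again such a
  polynomial, the whole set is invariant under \<open>deriv\<close>, and smoothness follows without
  formulas for higher derivatives.\<close>

inductive_set fun_algebra :: "(real \<Rightarrow> real) set \<Rightarrow> (real \<Rightarrow> real) set"
  for G where
  gen: "g \<in> G \<Longrightarrow> g \<in> fun_algebra G"
| const: "(\<lambda>_. a) \<in> fun_algebra G"
| add: "\<lbrakk>f \<in> fun_algebra G; g \<in> fun_algebra G\<rbrakk> \<Longrightarrow> (\<lambda>x. f x + g x) \<in> fun_algebra G"
| mult: "\<lbrakk>f \<in> fun_algebra G; g \<in> fun_algebra G\<rbrakk> \<Longrightarrow> (\<lambda>x. f x * g x) \<in> fun_algebra G"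

lemma smooth_fun_algebra:
  assumes gen: "\<And>g. g \<in> G \<Longrightarrow> \<exists>g' \<in> fun_algebra G. \<forall>x. (g has_real_derivative g' x) (at x)"
    and f: "f \<in> fun_algebra G"
  shows "smooth_fun f"
proof -
  have *: "\<exists>h' \<in> fun_algebra G. \<forall>x. (h has_real_derivative h' x) (at x)" if "h \<in> fun_algebra G" for h
    using that
  proof induction
    case (gen g)
    then show ?case using assms(1) by blast
  next
    case (const a)
    show ?case
      by (intro bexI[of _ "\<lambda>_. 0"] fun_algebra.const) auto
  next
    case (add f g)
    then obtain f' g' where "f' \<in> fun_algebra G" "g' \<in> fun_algebra G"
      "\<And>x. (f has_real_derivative f' x) (at x)" "\<And>x. (g has_real_derivative g' x) (at x)" by blast
    then show ?case
      by (intro bexI[of _ "\<lambda>x. f' x + g' x"] allI DERIV_add fun_algebra.add) auto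
  next
    case (mult f g)
    then obtain f' g' where "f' \<in> fun_algebra G" "g' \<in> fun_algebra G"
      "\<And>x. (f has_real_derivative f' x) (at x)" "\<And>x. (g has_real_derivative g' x) (at x)" by blast
    with mult.hyps show ?case
      by (intro bexI[of _ "\<lambda>x. f' x * g x + g' x * f x"] allI DERIV_mult
          fun_algebra.add fun_algebra.mult) auto
  qed
  show ?thesis
  proof (rule smooth_fun_if_deriv_closed[OF _ _ f])
    fix h x assume "h \<in> fun_algebra G"
    then show "h differentiable (at x)"
      using * real_differentiable_def by blast
  next
    fix h assume "h \<in> fun_algebra G"
    then obtain h' where "h' \<in> fun_algebra G" "\<And>x. (h has_real_derivative h' x) (at x)"
      using * by blast
    then show "deriv h \<in> fun_algebra G"
      using DERIV_imp_deriv by (metis ext)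
  qed
qed

lemma smooth_fun_has_deriv:
  assumes "smooth_fun f"
  shows "(f has_real_derivative deriv f x) (at x)"
    and "(deriv f has_real_derivative deriv (deriv f) x) (at x)"
proof -
  have "((deriv ^^ k) f) differentiable (at x)" for k
    using assms by (simp add: smooth_fun_def)
  from this[of 0] this[of 1]
  show "(f has_real_derivative deriv f x) (at x)"
    "(deriv f has_real_derivative deriv (deriv f) x) (at x)"
    by (auto simp: DERIV_deriv_iff_real_differentiable)
qed

section \<open>Gronwall's inequality and uniqueness for initial values\<close>

lemma gronwall_zero:
  fixes D :: "real \<Rightarrow> real"
  assumes D: "\<And>x. (D has_real_derivative D' x) (at x)"
    and bd: "\<And>x. \<bar>D' x\<bar> \<le> K * D x"
    and nonneg: "\<And>x. D x \<ge> 0" and zero: "D a = 0"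
  shows "D x = 0"
proof (cases "x \<ge> a")
  case True
  have "D x * exp (- K * x) \<le> D a * exp (- K * a)"
  proof (rule DERIV_nonpos_imp_nonincreasing[OF True])
    fix y
    have "((\<lambda>x. D x * exp (- K * x)) has_real_derivative (D' y - K * D y) * exp (- K * y)) (at y)"
      by (auto intro!: derivative_eq_intros D simp: algebra_simps)
    moreover have "(D' y - K * D y) * exp (- K * y) \<le> 0"
      using bd[of y] by (intro mult_nonpos_nonneg) auto
    ultimately show "\<exists>z. ((\<lambda>x. D x * exp (- K * x)) has_real_derivative z) (at y) \<and> z \<le> 0"
      by blast
  qed
  then have "D x * exp (- K * x) \<le> 0" using zero by simp
  then show ?thesis using nonneg[of x] by (simp add: mult_le_0_iff)
next
  case False
  then have "x \<le> a" by simp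
  have "D x * exp (K * x) \<le> D a * exp (K * a)"
  proof (rule DERIV_nonneg_imp_nondecreasing[OF \<open>x \<le> a\<close>])
    fix y
    have "((\<lambda>x. D x * exp (K * x)) has_real_derivative (D' y + K * D y) * exp (K * y)) (at y)"
      by (auto intro!: derivative_eq_intros D simp: algebra_simps)
    moreover have "(D' y + K * D y) * exp (K * y) \<ge> 0"
      using bd[of y] by (intro mult_nonneg_nonneg) auto
    ultimately show "\<exists>z. ((\<lambda>x. D x * exp (K * x)) has_real_derivative z) (at y) \<and> z \<ge> 0"
      by blast
  qed
  then have "D x * exp (K * x) \<le> 0" using zero by simp
  then show ?thesis using nonneg[of x] by (simp add: mult_le_0_iff)
qed

text \<open>Both right sides are plain functions of \<open>x\<close>, so the Lipschitz bound is
  asked only along the two given solutions. The squared distance \<open>D\<close> in phase space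
  then satisfies \<open>\<bar>D'\<bar> \<le> (1 + \<bar>L\<bar>) * D\<close>, and Gronwall applies
  in both directions of time.\<close>

lemma second_order_ode_unique:
  fixes f g :: "real \<Rightarrow> real"
  assumes f: "\<And>x. (f has_real_derivative f' x) (at x)" "\<And>x. (f' has_real_derivative F x) (at x)"
    and g: "\<And>x. (g has_real_derivative g' x) (at x)" "\<And>x. (g' has_real_derivative G x) (at x)"
    and lip: "\<And>x. \<bar>F x - G x\<bar> \<le> L * \<bar>f x - g x\<bar>"
    and init: "f a = g a" "f' a = g' a"
  shows "f x = g x"
proof -
  define D where "D x = (f x - g x)\<^sup>2 + (f' x - g' x)\<^sup>2" for x
  have "D x = 0"
  proof (rule gronwall_zero[where D = D and a = a])
    fix x
    show "(D has_real_derivative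
        2 * (f x - g x) * (f' x - g' x) + 2 * (f' x - g' x) * (F x - G x)) (at x)"
      unfolding D_def by (auto intro!: derivative_eq_intros f g simp: algebra_simps)
    have am: "2 * \<bar>p\<bar> * \<bar>q\<bar> \<le> p\<^sup>2 + q\<^sup>2" for p q :: real
      using sum_squares_bound[of "\<bar>p\<bar>" "\<bar>q\<bar>"] by simp
    have "\<bar>2 * (f x - g x) * (f' x - g' x) + 2 * (f' x - g' x) * (F x - G x)\<bar>
      \<le> 2 * \<bar>f x - g x\<bar> * \<bar>f' x - g' x\<bar> + 2 * \<bar>f' x - g' x\<bar> * \<bar>F x - G x\<bar>"
      by (rule order_trans[OF abs_triangle_ineq]) (simp only: abs_mult abs_numeral order_refl)
    also have "\<dots> \<le> 2 * \<bar>f x - g x\<bar> * \<bar>f' x - g' x\<bar> + 2 * \<bar>f' x - g' x\<bar> * (\<bar>L\<bar> * \<bar>f x - g x\<bar>)"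
      using lip[of x] abs_ge_self[of L]
      by (intro add_left_mono mult_left_mono order_trans[OF lip] mult_right_mono) auto
    also have "\<dots> = (1 + \<bar>L\<bar>) * (2 * \<bar>f x - g x\<bar> * \<bar>f' x - g' x\<bar>)" by (simp add: algebra_simps)
    also have "\<dots> \<le> (1 + \<bar>L\<bar>) * D x"
      unfolding D_def by (intro mult_left_mono am) auto
    finally show "\<bar>2 * (f x - g x) * (f' x - g' x) + 2 * (f' x - g' x) * (F x - G x)\<bar>
      \<le> (1 + \<bar>L\<bar>) * D x" .
    show "D x \<ge> 0" by (simp add: D_def)
  qed (simp add: D_def init)
  then show ?thesis
    unfolding D_def by (simp add: sum_power2_eq_zero_iff)
qed

section \<open>A scalar autonomous equation solved by quadrature\<close>

text \<open>Separation of variables: \<open>y\<close> is the inverse of the travel time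
  \<open>T\<close>, the integral of \<open>1 / R\<close> from 0. Positivity of \<open>R\<close>
  makes \<open>T\<close> invertible, the linear bound at \<open>S\<close> makes \<open>T\<close>
  diverge there so that \<open>y\<close> is defined for all times, and evenness of \<open>R\<close>
  makes \<open>T\<close> odd, which settles the other end.\<close>

lemma autonomous_ode_exists:
  fixes R :: "real \<Rightarrow> real"
  assumes "S > 0" and cont: "\<And>s. \<bar>s\<bar> < S \<Longrightarrow> isCont R s"
    and pos: "\<And>s. \<bar>s\<bar> < S \<Longrightarrow> R s > 0" and even: "\<And>s. R (- s) = R s"
    and b: "0 \<le> b" "b < S" and upper: "\<And>s. b \<le> s \<Longrightarrow> s < S \<Longrightarrow> R s \<le> C * (S - s)"
  obtains y where "y 0 = 0" "\<And>x. y (- x) = - y x" "\<And>x. \<bar>y x\<bar> < S"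
    "\<And>x. (y has_real_derivative R (y x)) (at x)" "(y \<longlongrightarrow> S) at_top"
proof -
  have "\<exists>F. \<forall>s::real. ereal (- S) < s \<longrightarrow> s < ereal S \<longrightarrow>
      (F has_vector_derivative inverse (R s)) (at s)"
  proof (rule einterval_antiderivative)
    fix s :: real assume "ereal (- S) < s" "s < ereal S"
    then have "\<bar>s\<bar> < S" by auto
    with pos[of s] show "isCont (\<lambda>s. inverse (R s)) s"
      by (intro continuous_at_within_inverse cont) auto
  qed (use \<open>S > 0\<close> in auto)
  then obtain F where F: "\<And>s. \<bar>s\<bar> < S \<Longrightarrow> (F has_real_derivative inverse (R s)) (at s)"
    by (auto simp: has_real_derivative_iff_has_vector_derivative abs_less_iff minus_less_iff)
  define T where "T s = F s - F 0" for s
  have T: "(T has_real_derivative inverse (R s)) (at s)" if "\<bar>s\<bar> < S" for s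
    unfolding T_def by (rule derivative_eq_intros F[OF that] refl | simp)+
  have mono: "T s < T t" if "- S < s" "s < t" "t < S" for s t
  proof (rule DERIV_pos_imp_increasing[OF \<open>s < t\<close>])
    fix r assume "s \<le> r" "r \<le> t"
    then have "\<bar>r\<bar> < S" using that by auto
    with T[OF this] pos[OF this] show "\<exists>z. (T has_real_derivative z) (at r) \<and> 0 < z"
      by (auto intro!: exI[of _ "inverse (R r)"])
  qed
  have mono_iff: "T s < T t \<longleftrightarrow> s < t" if "\<bar>s\<bar> < S" "\<bar>t\<bar> < S" for s t
    using mono[of s t] mono[of t s] that by (cases s t rule: linorder_cases) (auto simp: abs_less_iff)
  have odd: "T (- s) = - T s" if "\<bar>s\<bar> < S" for s
  proof -
    have "\<exists>c. \<forall>r\<in>{-S<..<S}. T r + T (- r) = c"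
    proof (rule has_field_derivative_zero_constant)
      fix r assume r: "r \<in> {-S<..<S}"
      then have "((\<lambda>r. T r + T (- r)) has_real_derivative inverse (R r) + inverse (R (- r)) * (- 1)) (at r)"
        by (intro DERIV_add DERIV_chain2[of T] T derivative_eq_intros) auto
      then show "((\<lambda>r. T r + T (- r)) has_real_derivative 0) (at r within {-S<..<S})"
        by (simp add: even has_field_derivative_at_within)
    qed auto
    then obtain c where c: "\<And>r. \<bar>r\<bar> < S \<Longrightarrow> T r + T (- r) = c" by (auto simp: abs_less_iff)
    from c[of 0] c[OF that] \<open>S > 0\<close> show ?thesis by (simp add: T_def)
  qed
  have "0 < R b" using b by (intro pos) auto
  also have "\<dots> \<le> C * (S - b)" using b by (intro upper) auto
  finally have "C > 0" using b by (simp add: zero_less_mult_iff)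
  have unbounded: "\<exists>s. b \<le> s \<and> s < S \<and> M \<le> T s" for M
  proof -
    \<comment> \<open>Comparison with \<open>1 / (C * (S - r))\<close> shows that \<open>T\<close>
      grows by at least \<open>inverse C * ln ((S - b) / (S - s))\<close> between \<open>b\<close>
      and \<open>s\<close>; this \<open>s\<close> makes the growth equal to
      \<open>d\<close>.\<close>
    define d where "d = \<bar>M - T b\<bar>"
    define s where "s = S - (S - b) * exp (- C * d)"
    have e: "0 < (S - b) * exp (- C * d)" "(S - b) * exp (- C * d) \<le> S - b"
      using b \<open>C > 0\<close> by (auto simp: d_def mult_le_cancel_left1)
    then have s: "b \<le> s" "s < S" by (auto simp: s_def)
    have "T b + inverse C * ln (S - b) \<le> T s + inverse C * ln (S - s)"
    proof (rule DERIV_nonneg_imp_nondecreasing[OF \<open>b \<le> s\<close>])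
      fix r assume r: "b \<le> r" "r \<le> s"
      then have r': "\<bar>r\<bar> < S" using b s by auto
      have "((\<lambda>s. T s + inverse C * ln (S - s)) has_real_derivative inverse (R r) - inverse (C * (S - r))) (at r)"
        using r' by (auto intro!: derivative_eq_intros T simp: divide_inverse)
      moreover have "inverse (C * (S - r)) \<le> inverse (R r)"
        using r r' s by (intro le_imp_inverse_le pos upper) auto
      ultimately show "\<exists>z. ((\<lambda>s. T s + inverse C * ln (S - s)) has_real_derivative z) (at r) \<and> 0 \<le> z"
        by (intro exI conjI) auto
    qed
    also have "ln (S - s) = ln (S - b) - C * d"
      using b by (simp add: s_def ln_mult)
    also have "inverse C * \<dots> = inverse C * ln (S - b) - d"
      using \<open>C > 0\<close> by (simp add: right_diff_distrib)
    finally have "T b + d \<le> T s" by simp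
    with s show ?thesis by (intro exI[of _ s]) (auto simp: d_def)
  qed
  have T0: "T 0 = 0" by (simp add: T_def)
  have contT: "isCont T s" if "\<bar>s\<bar> < S" for s
    using T[OF that] by (rule DERIV_isCont)
  have surj_nonneg: "\<exists>s. \<bar>s\<bar> < S \<and> T s = x" if "x \<ge> 0" for x
  proof -
    obtain t where t: "b \<le> t" "t < S" "x \<le> T t" using unbounded by blast
    have "\<exists>s\<ge>0. s \<le> t \<and> T s = x"
      using t that T0 b by (intro IVT) (auto intro!: contT)
    then obtain s where "0 \<le> s" "s \<le> t" "T s = x" by blast
    with t show ?thesis by (intro exI[of _ s]) auto
  qed
  have surj: "\<exists>s. \<bar>s\<bar> < S \<and> T s = x" for x
  proof (cases "x \<ge> 0")
    case False
    then obtain s where "\<bar>s\<bar> < S" "T s = - x" using surj_nonneg[of "- x"] by auto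
    then show ?thesis using odd by (intro exI[of _ "- s"]) auto
  qed (rule surj_nonneg)
  then obtain y where y: "\<And>x. \<bar>y x\<bar> < S" "\<And>x. T (y x) = x" by metis
  have yT: "y (T s) = s" if "\<bar>s\<bar> < S" for s
    using mono_iff[OF y(1)[of "T s"] that] mono_iff[OF that y(1)[of "T s"]] y(2)[of "T s"] by auto
  have isCont: "isCont y x" for x
  proof -
    obtain p where p: "- S < p" "p < y x"
      using dense[of "- S" "y x"] y(1)[of x] by force
    obtain q where q: "y x < q" "q < S"
      using dense[of "y x" S] y(1)[of x] by force
    have "isCont y (T (y x))"
      by (rule isCont_inverse_function2[of p _ q]) (use p q in \<open>auto intro!: yT contT\<close>)
    then show ?thesis by (simp add: y)
  qed
  show thesis
  proof
    show "y 0 = 0" using yT[of 0] \<open>S > 0\<close> by (simp add: T0)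
    show "\<bar>y x\<bar> < S" for x by (rule y)
    show "y (- x) = - y x" for x
      using yT[of "- y x"] odd[OF y(1)[of x]] y(1)[of x] by (simp add: y(2))
    show "(y has_real_derivative R (y x)) (at x)" for x
      using DERIV_inverse_function[where f = T and g = y and x = x and a = "x - 1" and b = "x + 1",
            OF T[OF y(1)[of x]]] pos[OF y(1)[of x]]
        y(2) isCont by auto
    show "(y \<longlongrightarrow> S) at_top"
    proof (rule order_tendstoI)
      fix a assume "a < S"
      define r where "r = max a 0"
      have r: "\<bar>r\<bar> < S" using \<open>a < S\<close> \<open>S > 0\<close> by (auto simp: r_def)
      have "r < y x" if "x > T r" for x
        using mono_iff[OF r y(1)[of x]] that by (simp add: y)
      then have "a < y x" if "x > T r" for x
        using that by (fastforce simp: r_def)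
      then show "\<forall>\<^sub>F x in at_top. a < y x"
        using eventually_gt_at_top[of "T r"] by (rule eventually_mono[rotated])
    next
      fix a assume "S < a"
      have "y x < a" for x using y(1)[of x] \<open>S < a\<close> by linarith
      then show "\<forall>\<^sub>F x in at_top. y x < a" by simp
    qed
  qed
qed

section \<open>The energy function and the critical speeds\<close>

text \<open>With \<open>v = 1/n\<close>, the first two equations integrate to \<open>u = c (1 - v)\<close> and
  \<open>\<phi> = potential \<sigma> c v\<close>, and Poisson's equation to \<open>\<epsilon> \<phi>'\<^sup>2 / 2 = energy \<sigma> c v\<close>.\<close>

definition potential :: "real \<Rightarrow> real \<Rightarrow> real \<Rightarrow> real" where
  "potential \<sigma> c v = c\<^sup>2 / 2 * (1 - v\<^sup>2) + \<sigma> * ln v"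

definition potential_deriv :: "real \<Rightarrow> real \<Rightarrow> real \<Rightarrow> real" where
  "potential_deriv \<sigma> c v = \<sigma> / v - c\<^sup>2 * v"

definition energy :: "real \<Rightarrow> real \<Rightarrow> real \<Rightarrow> real" where
  "energy \<sigma> c v = exp (potential \<sigma> c v) - 1 - c\<^sup>2 * (1 - v) + \<sigma> * (1 / v - 1)"

lemma potential_has_deriv:
  "v > 0 \<Longrightarrow> (potential \<sigma> c has_real_derivative potential_deriv \<sigma> c v) (at v)"
  unfolding potential_def potential_deriv_def
  by (auto intro!: derivative_eq_intros simp: field_simps)

text \<open>The derivative is the right side of Poisson's equation times d\<phi>/dv, which is why
  multiplying that equation by \<phi>' produces a first integral.\<close>

lemma energy_has_deriv:
  assumes "v > 0"
  shows "(energy \<sigma> c has_real_derivative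
    (exp (potential \<sigma> c v) - 1 / v) * potential_deriv \<sigma> c v) (at v)"
proof -
  have "(energy \<sigma> c has_real_derivative
    exp (potential \<sigma> c v) * potential_deriv \<sigma> c v + c\<^sup>2 - \<sigma> / v\<^sup>2) (at v)"
    unfolding energy_def using assms
    by (auto intro!: derivative_eq_intros potential_has_deriv simp: power2_eq_square)
  moreover have "c\<^sup>2 - \<sigma> / v\<^sup>2 = - (1 / v * potential_deriv \<sigma> c v)"
    using assms by (simp add: potential_deriv_def field_simps power2_eq_square)
  ultimately show ?thesis
    by (metis (no_types, opaque_lifting) add_diff_eq left_diff_distrib' diff_conv_add_uminus)
qed

lemma potential_1 [simp]: "potential \<sigma> c 1 = 0"
  by (simp add: potential_def)

lemma energy_1 [simp]: "energy \<sigma> c 1 = 0"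
  by (simp add: energy_def)

section \<open>The equations defining \<open>zeta\<close> and the upper bound on the speed\<close>

definition zeta_log :: "real \<Rightarrow> real \<Rightarrow> real" where
  "zeta_log \<sigma> z = \<sigma> * ln z + ln (\<sigma> * (z - 1)\<^sup>2 + 1) - \<sigma> / 2 * (z\<^sup>2 - 1)"

text \<open>\<open>zeta_log\<close> is the logarithm of the quotient of the two sides of the
  equation for \<open>zeta\<close>. The factored derivative shows that beyond 1 its only critical
  point is \<open>sqrt ((1 + \<sigma>) / \<sigma>)\<close>, the lower bound imposed on the speed:
  the function rises before it and falls after it.\<close>

lemma zeta_log_has_deriv:
  assumes "\<sigma> > 0" "z > 0"
  shows "(zeta_log \<sigma> has_real_derivative
    \<sigma> * (z - 1)\<^sup>2 * (1 + \<sigma> - \<sigma> * z\<^sup>2) / (z * (\<sigma> * (z - 1)\<^sup>2 + 1))) (at z)"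
proof -
  have p: "\<sigma> * (z - 1)\<^sup>2 + 1 > 0"
    using assms by (intro add_nonneg_pos) auto
  have "(zeta_log \<sigma> has_real_derivative
      \<sigma> / z + 2 * \<sigma> * (z - 1) / (\<sigma> * (z - 1)\<^sup>2 + 1) - \<sigma> * z) (at z)"
    unfolding zeta_log_def using assms p
    by (auto intro!: derivative_eq_intros)
  also have "\<sigma> / z + 2 * \<sigma> * (z - 1) / (\<sigma> * (z - 1)\<^sup>2 + 1) - \<sigma> * z
    = \<sigma> * (z - 1)\<^sup>2 * (1 + \<sigma> - \<sigma> * z\<^sup>2) / (z * (\<sigma> * (z - 1)\<^sup>2 + 1))"
  proof -
    define q where "q = \<sigma> * (z - 1)\<^sup>2 + 1"
    have "q > 0" using p by (simp add: q_def)
    have "\<sigma> * q + 2 * \<sigma> * (z - 1) * z - \<sigma> * z\<^sup>2 * q = \<sigma> * (z - 1)\<^sup>2 * (1 + \<sigma> - \<sigma> * z\<^sup>2)"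
      unfolding q_def by algebra
    then show ?thesis
      using assms(2) \<open>q > 0\<close> unfolding q_def[symmetric] by (simp add: field_simps power2_eq_square)
  qed
  finally show ?thesis .
qed

lemma zeta_eq_iff_zeta_log:
  assumes "\<sigma> > 0" "z > 0"
  shows "z powr \<sigma> * (\<sigma> * (z - 1)\<^sup>2 + 1) = exp (\<sigma> / 2 * (z\<^sup>2 - 1)) \<longleftrightarrow> zeta_log \<sigma> z = 0"
proof -
  have p: "\<sigma> * (z - 1)\<^sup>2 + 1 > 0"
    using assms by (intro add_nonneg_pos) auto
  have "z powr \<sigma> * (\<sigma> * (z - 1)\<^sup>2 + 1) = exp (\<sigma> * ln z + ln (\<sigma> * (z - 1)\<^sup>2 + 1))"
    using p assms by (simp add: powr_def exp_add)
  then show ?thesis by (simp add: zeta_log_def)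
qed

text \<open>\<open>zeta\<close> is a definite description, so its value is known only once a root is
  at hand. A nonpositive value at \<open>z\<close> supplies one: \<open>zeta_log\<close> is positive
  at the critical point, hence vanishes somewhere up to \<open>z\<close>, and by uniqueness that
  root is \<open>zeta \<sigma>\<close>, contradicting \<open>z < zeta \<sigma>\<close>.\<close>

lemma zeta_log_pos_below_zeta:
  assumes "\<sigma> > 0" and z: "sqrt ((1 + \<sigma>) / \<sigma>) < z" "z < zeta \<sigma>"
  shows "zeta_log \<sigma> z > 0"
proof (rule ccontr)
  assume neg: "\<not> zeta_log \<sigma> z > 0"
  define s where "s = sqrt ((1 + \<sigma>) / \<sigma>)"
  have s: "1 < s" using \<open>\<sigma> > 0\<close> by (simp add: s_def)
  have s2: "\<sigma> * s\<^sup>2 = 1 + \<sigma>" using \<open>\<sigma> > 0\<close> by (simp add: s_def)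
  have cont: "isCont (zeta_log \<sigma>) x" if "x > 0" for x
    using zeta_log_has_deriv[OF \<open>\<sigma> > 0\<close> that] by (rule DERIV_isCont)
  have "zeta_log \<sigma> 1 < zeta_log \<sigma> s"
  proof (rule DERIV_pos_imp_increasing_open[OF s])
    fix x assume x: "1 < x" "x < s"
    have "\<sigma> * x\<^sup>2 < \<sigma> * s\<^sup>2" using x \<open>\<sigma> > 0\<close> by (intro mult_strict_left_mono power_strict_mono) auto
    then have "0 < \<sigma> * (x - 1)\<^sup>2 * (1 + \<sigma> - \<sigma> * x\<^sup>2) / (x * (\<sigma> * (x - 1)\<^sup>2 + 1))"
      using x \<open>\<sigma> > 0\<close> s2 by (intro divide_pos_pos mult_pos_pos add_nonneg_pos) auto
    then show "\<exists>y. (zeta_log \<sigma> has_real_derivative y) (at x) \<and> 0 < y"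
      using zeta_log_has_deriv[of \<sigma> x] x \<open>\<sigma> > 0\<close> by auto
  qed (auto intro!: continuous_at_imp_continuous_on cont)
  then have s_pos: "zeta_log \<sigma> s > 0" by (simp add: zeta_log_def)
  \<comment> \<open>Since 1 is itself a zero of \<open>zeta_log\<close>, two further zeros would
    give, by Rolle, two distinct critical points beyond 1.\<close>
  have unique: False if pq: "1 < p" "p < q" "zeta_log \<sigma> p = 0" "zeta_log \<sigma> q = 0" for p q
  proof -
    have crit: "\<exists>x. a < x \<and> x < b \<and> \<sigma> * x\<^sup>2 = 1 + \<sigma>"
      if "1 \<le> a" "a < b" "zeta_log \<sigma> a = 0" "zeta_log \<sigma> b = 0" for a b
    proof -
      have "\<exists>x>a. x < b \<and> (zeta_log \<sigma> has_real_derivative 0) (at x)"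
      proof (rule Rolle)
        show "continuous_on {a..b} (zeta_log \<sigma>)"
          using that by (intro continuous_at_imp_continuous_on ballI cont) auto
        show "zeta_log \<sigma> differentiable (at x)" if "a < x" for x
          using zeta_log_has_deriv[OF \<open>\<sigma> > 0\<close>, of x] that \<open>1 \<le> a\<close>
          by (auto simp: real_differentiable_def)
      qed (use that in auto)
      then obtain x where x: "a < x" "x < b" "(zeta_log \<sigma> has_real_derivative 0) (at x)" by blast
      have "\<sigma> * (x - 1)\<^sup>2 + 1 > 0"
        using \<open>\<sigma> > 0\<close> by (intro add_nonneg_pos) auto
      moreover have "\<sigma> * (x - 1)\<^sup>2 * (1 + \<sigma> - \<sigma> * x\<^sup>2) / (x * (\<sigma> * (x - 1)\<^sup>2 + 1)) = 0"
        using zeta_log_has_deriv[OF \<open>\<sigma> > 0\<close>, of x] x that by (intro DERIV_unique[OF _ x(3)]) auto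
      ultimately show ?thesis using x that \<open>\<sigma> > 0\<close> by (intro exI[of _ x]) auto
    qed
    obtain x where x: "1 < x" "x < p" "\<sigma> * x\<^sup>2 = 1 + \<sigma>"
      using crit[of 1 p] pq by (auto simp: zeta_log_def)
    obtain y where y: "p < y" "\<sigma> * y\<^sup>2 = 1 + \<sigma>"
      using crit[of p q] pq by auto
    have "\<sigma> * x\<^sup>2 < \<sigma> * y\<^sup>2" using x y \<open>\<sigma> > 0\<close> by (intro mult_strict_left_mono power_strict_mono) auto
    then show False using x y by simp
  qed
  have root_le: "zeta \<sigma> = r" if "1 < r" "zeta_log \<sigma> r = 0" for r
  proof -
    have "zeta \<sigma> = (THE z. 1 < z \<and> zeta_log \<sigma> z = 0)"
      unfolding zeta_def using \<open>\<sigma> > 0\<close>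
      by (simp add: zeta_eq_iff_zeta_log[simplified] cong: conj_cong)
    also have "\<dots> = r"
    proof (rule the_equality)
      show "z = r" if "1 < z \<and> zeta_log \<sigma> z = 0" for z
        using that \<open>1 < r\<close> \<open>zeta_log \<sigma> r = 0\<close> unique[of r z] unique[of z r] by (cases z r rule: linorder_cases) auto
    qed (use that in simp)
    finally show ?thesis .
  qed
  have "\<exists>r\<ge>s. r \<le> z \<and> zeta_log \<sigma> r = 0"
    using z s s_pos neg by (intro IVT2) (auto simp: s_def[symmetric] intro!: cont)
  then obtain r where "s \<le> r" "r \<le> z" "zeta_log \<sigma> r = 0" by blast
  with root_le[of r] s z show False by auto
qed

text \<open>The same argument in the variable \<open>w = z\<^sup>2\<close>: \<open>h\<close>
  vanishes at 0, and its derivative vanishes only where \<open>exp (w / 2) = 2\<close>, so by Rolle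
  there is at most one positive zero.\<close>

lemma below_zeta_0:
  assumes "1 < z" "z < zeta 0"
  shows "exp (z\<^sup>2 / 2) < z\<^sup>2 + 1"
proof (rule ccontr)
  assume neg: "\<not> exp (z\<^sup>2 / 2) < z\<^sup>2 + 1"
  define h where "h w = exp (w / 2) - w - (1::real)" for w
  have h: "(h has_real_derivative exp (w / 2) / 2 - 1) (at w)" for w
    unfolding h_def by (auto intro!: derivative_eq_intros)
  have cont: "isCont h w" for w using h by (rule DERIV_isCont)
  have unique: False if pq: "0 < p" "p < q" "h p = 0" "h q = 0" for p q
  proof -
    have crit: "\<exists>x. a < x \<and> x < b \<and> exp (x / 2) / 2 - 1 = 0" if "a < b" "h a = 0" "h b = 0" for a b
    proof -
      have "\<exists>x>a. x < b \<and> (h has_real_derivative 0) (at x)"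
      proof (rule Rolle)
        show "continuous_on {a..b} h"
          by (intro continuous_at_imp_continuous_on ballI cont)
        show "h differentiable (at x)" for x
          using h by (auto simp: real_differentiable_def)
      qed (use that in auto)
      then show ?thesis using h DERIV_unique by blast
    qed
    obtain x where x: "x < p" "exp (x / 2) / 2 - 1 = 0"
      using crit[of 0 p] pq by (auto simp: h_def)
    obtain y where y: "p < y" "exp (y / 2) / 2 - 1 = 0"
      using crit[of p q] pq by auto
    have "exp (x / 2) = exp (y / 2)" using x y by simp
    then show False using x y by simp
  qed
  have root: "zeta 0 = r" if "0 < r" "h (r\<^sup>2) = 0" for r
  proof -
    have "x = r" if "0 < x" "x\<^sup>2 + 1 = exp (x\<^sup>2 / 2)" for x
    proof -
      have "h (x\<^sup>2) = 0" using that by (simp add: h_def)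
      then have "x\<^sup>2 = r\<^sup>2"
        using unique[of "x\<^sup>2" "r\<^sup>2"] unique[of "r\<^sup>2" "x\<^sup>2"] that \<open>0 < r\<close> \<open>h (r\<^sup>2) = 0\<close>
        by (metis linorder_neqE_linordered_idom zero_less_power)
      then show ?thesis using that \<open>0 < r\<close> by simp
    qed
    moreover have "r\<^sup>2 + 1 = exp (r\<^sup>2 / 2)"
      using that by (simp add: h_def)
    ultimately have "(THE x. 0 < x \<and> x\<^sup>2 + 1 = exp (x\<^sup>2 / 2)) = r"
      using that by (intro the_equality) blast+
    then show ?thesis
      by (simp add: zeta_def)
  qed
  \<comment> \<open>This makes \<open>h\<close> negative at 1, the left end of the interval on which
    a root is found.\<close>
  have "exp (1/2::real) < 2"
  proof -
    have "exp (1/2::real) \<le> 1 + 1/2 + (1/2)\<^sup>2"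
      by (rule exp_bound) auto
    then show ?thesis by (simp add: power2_eq_square)
  qed
  then have "h 1 < 0" by (simp add: h_def)
  have "\<exists>w\<ge>1. w \<le> z\<^sup>2 \<and> h w = 0"
  proof (rule IVT)
    show "0 \<le> h (z\<^sup>2)" using neg by (simp add: h_def)
  qed (use assms \<open>h 1 < 0\<close> cont in auto)
  then obtain w where w: "1 \<le> w" "w \<le> z\<^sup>2" "h w = 0" by blast
  then have "zeta 0 = sqrt w" by (intro root) auto
  also have "sqrt w \<le> z" using w assms by (intro real_le_lsqrt) auto
  finally show False using assms by simp
qed

text \<open>For \<open>\<sigma> = 0\<close> the sonic value is \<open>0\<close>; the junk values of \<open>ln 0\<close> and \<open>1 / 0\<close> in
  \<^const>\<open>energy\<close> are then multiplied by \<open>\<sigma> = 0\<close>, so both cases have the same form.\<close>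

lemma energy_sonic_neg:
  assumes "\<sigma> \<ge> 0" "c > 0"
    and "\<sigma> > 0 \<Longrightarrow> sqrt ((1 + \<sigma>) / \<sigma>) < c / sqrt \<sigma> \<and> c / sqrt \<sigma> < zeta \<sigma>"
    and "\<sigma> = 0 \<Longrightarrow> 1 < c \<and> c < zeta 0"
  shows "energy \<sigma> c (sqrt \<sigma> / c) < 0"
proof (cases "\<sigma> = 0")
  case True
  then show ?thesis
    using assms(4) below_zeta_0[of c] by (simp add: energy_def potential_def)
next
  case False
  then have "\<sigma> > 0" using assms by simp
  \<comment> \<open>In this variable the sonic value is \<open>inverse z\<close>, the
    non-exponential terms of the energy collapse to
    \<open>- (\<sigma> * (z - 1)\<^sup>2 + 1)\<close>, and after taking logarithms negativity of the
    energy is positivity of \<open>zeta_log \<sigma> z\<close>.\<close>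
  define z where "z = c / sqrt \<sigma>"
  have "z > 0" using \<open>\<sigma> > 0\<close> \<open>c > 0\<close> by (simp add: z_def)
  have c2: "c\<^sup>2 = \<sigma> * z\<^sup>2" using \<open>\<sigma> > 0\<close> by (simp add: z_def power_divide)
  have p: "\<sigma> * (z - 1)\<^sup>2 + 1 > 0"
    using \<open>\<sigma> > 0\<close> by (intro add_nonneg_pos) auto
  have v: "sqrt \<sigma> / c = inverse z" by (simp add: z_def)
  have "potential \<sigma> c (inverse z) = \<sigma> / 2 * (z\<^sup>2 - 1) - \<sigma> * ln z"
    using \<open>z > 0\<close> by (simp add: potential_def c2 ln_inverse power_inverse right_diff_distrib)
  also have "\<dots> < ln (\<sigma> * (z - 1)\<^sup>2 + 1)"
    using zeta_log_pos_below_zeta[OF \<open>\<sigma> > 0\<close>, of z] assms(3)[OF \<open>\<sigma> > 0\<close>]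
    by (simp add: z_def[symmetric] zeta_log_def)
  finally have "exp (potential \<sigma> c (inverse z)) < \<sigma> * (z - 1)\<^sup>2 + 1"
    using p by (metis exp_less_cancel_iff exp_ln)
  moreover have "c\<^sup>2 * (1 - inverse z) - \<sigma> * (1 / inverse z - 1) = \<sigma> * (z - 1)\<^sup>2"
    unfolding c2 using \<open>z > 0\<close> by (simp add: field_simps power2_eq_square)
  ultimately show ?thesis
    unfolding v energy_def by linarith
qed

text \<open>The two speed bounds in the form in which they act:
  \<open>1 + \<sigma> < c\<^sup>2\<close> is the lower one and \<open>sonic\<close> the upper one.
  In this form \<sigma> = 0 and \<sigma> > 0 are treated together.\<close>

locale supersonic =
  fixes \<sigma> c :: real
  assumes \<sigma>: "\<sigma> \<ge> 0" and c: "c > 0" and supersonic: "1 + \<sigma> < c\<^sup>2"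
    and sonic: "energy \<sigma> c (sqrt \<sigma> / c) < 0"
begin

abbreviation "\<Phi> \<equiv> potential \<sigma> c"
abbreviation "\<Phi>' \<equiv> potential_deriv \<sigma> c"
abbreviation "E \<equiv> energy \<sigma> c"
abbreviation "v\<^sub>s \<equiv> sqrt \<sigma> / c"

lemma sonic_nonneg: "0 \<le> v\<^sub>s"
  using \<sigma> c by simp

lemma sonic_less_1: "v\<^sub>s < 1"
proof -
  have "sqrt \<sigma> < c" using supersonic \<sigma> c by (intro real_less_lsqrt) auto
  then show ?thesis using c by simp
qed

lemma potential_deriv_neg:
  assumes "v\<^sub>s < v"
  shows "\<Phi>' v < 0"
proof -
  have "v > 0" using assms sonic_nonneg by linarith
  have "\<sigma> / c\<^sup>2 < v\<^sup>2"
    using power_strict_mono[OF assms sonic_nonneg, of 2] \<sigma> by (simp add: power_divide)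
  then show ?thesis
    using c \<open>v > 0\<close> by (simp add: potential_deriv_def field_simps power2_eq_square)
qed

text \<open>For \<sigma> = 0 the sonic value is 0, outside the range of
  \<open>energy_has_deriv\<close>; there the singular terms carry the factor 0 and the remaining
  expression is continuous.\<close>

lemma isCont_energy_sonic: "isCont E v\<^sub>s"
proof (cases "\<sigma> = 0")
  case True
  then have "E = (\<lambda>v. exp (c\<^sup>2 / 2 * (1 - v\<^sup>2)) - 1 - c\<^sup>2 * (1 - v))"
    by (simp add: energy_def potential_def fun_eq_iff)
  then show ?thesis by (simp add: continuous_intros)
next
  case False
  then show ?thesis
    using \<sigma> c by (intro DERIV_isCont[OF energy_has_deriv]) auto
qed

text \<open>The zeros of \<open>k\<close> are the equilibria of Poisson's equation.\<close>

definition k :: "real \<Rightarrow> real" where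
  "k v = \<Phi> v + ln v"

lemma k_has_deriv: "v > 0 \<Longrightarrow> (k has_real_derivative (1 + \<sigma>) / v - c\<^sup>2 * v) (at v)"
  unfolding k_def
  by (auto intro!: derivative_eq_intros potential_has_deriv simp: potential_deriv_def field_simps)

lemma k_sign:
  assumes "v > 0"
  shows "k v > 0 \<longleftrightarrow> 1 / v < exp (\<Phi> v)" "k v < 0 \<longleftrightarrow> exp (\<Phi> v) < 1 / v"
proof -
  have "1 / v = exp (- ln v)" using assms by (simp add: exp_minus inverse_eq_divide)
  then show "k v > 0 \<longleftrightarrow> 1 / v < exp (\<Phi> v)" "k v < 0 \<longleftrightarrow> exp (\<Phi> v) < 1 / v"
    unfolding k_def by auto
qed

text \<open>The critical point of \<open>k\<close>, where
  \<open>(1 + \<sigma>) / v = c\<^sup>2 * v\<close>. The lower speed bound places it to the left of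
  the equilibrium 1, so \<open>k\<close> is positive just below 1 and negative above 1.\<close>

definition k_max :: real where
  "k_max = sqrt (1 + \<sigma>) / c"

lemma k_max: "0 < k_max" "k_max < 1" "c\<^sup>2 * k_max\<^sup>2 = 1 + \<sigma>"
proof -
  show "0 < k_max" using \<sigma> c by (simp add: k_max_def)
  have "sqrt (1 + \<sigma>) < c" using supersonic \<sigma> c by (intro real_less_lsqrt) auto
  then show "k_max < 1" using c by (simp add: k_max_def)
  show "c\<^sup>2 * k_max\<^sup>2 = 1 + \<sigma>" using \<sigma> c by (simp add: k_max_def power_divide)
qed

lemma k_strict_mono:
  assumes "0 < v" "v < w" "w \<le> k_max"
  shows "k v < k w"
proof (rule DERIV_pos_imp_increasing_open[OF \<open>v < w\<close>])
  fix x assume x: "v < x" "x < w"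
  have "c\<^sup>2 * x\<^sup>2 < c\<^sup>2 * k_max\<^sup>2"
    using x assms c by (intro mult_strict_left_mono power_strict_mono) auto
  then have "c\<^sup>2 * x\<^sup>2 < 1 + \<sigma>" by (simp only: k_max(3))
  then have "0 < (1 + \<sigma>) / x - c\<^sup>2 * x"
    using x assms by (simp add: field_simps power2_eq_square)
  then show "\<exists>y. (k has_real_derivative y) (at x) \<and> 0 < y"
    using k_has_deriv[of x] x assms by auto
qed (use assms in \<open>auto intro!: continuous_at_imp_continuous_on DERIV_isCont[OF k_has_deriv]\<close>)

lemma k_strict_antimono:
  assumes "k_max \<le> v" "v < w"
  shows "k w < k v"
proof (rule DERIV_neg_imp_decreasing_open[OF \<open>v < w\<close>])
  fix x assume x: "v < x" "x < w"
  have "c\<^sup>2 * k_max\<^sup>2 < c\<^sup>2 * x\<^sup>2"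
    using x assms c k_max(1) by (intro mult_strict_left_mono power_strict_mono) auto
  then have "1 + \<sigma> < c\<^sup>2 * x\<^sup>2" by (simp only: k_max(3))
  then have "(1 + \<sigma>) / x - c\<^sup>2 * x < 0"
    using x assms k_max(1) by (simp add: field_simps power2_eq_square)
  then show "\<exists>y. (k has_real_derivative y) (at x) \<and> y < 0"
    using k_has_deriv[of x] x assms k_max(1) by auto
qed (use assms k_max(1) in \<open>auto intro!: continuous_at_imp_continuous_on DERIV_isCont[OF k_has_deriv]\<close>)

lemma k_1 [simp]: "k 1 = 0"
  by (simp add: k_def)

lemma exp_potential_less: "1 < v \<Longrightarrow> exp (\<Phi> v) < 1 / v"
  using k_strict_antimono[of 1 v] k_max k_sign[of v] by simp

text \<open>As \<open>\<Phi>'\<close> is negative beyond the sonic value, the energy rises where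
  \<open>k\<close> is negative and, in the companion lemma, falls where \<open>k\<close> is
  positive.\<close>

lemma energy_strict_mono:
  assumes "v\<^sub>s < v" "v < w" and neg: "\<And>x. v < x \<Longrightarrow> x < w \<Longrightarrow> k x < 0"
  shows "E v < E w"
proof (rule DERIV_pos_imp_increasing_open[OF \<open>v < w\<close>])
  fix x assume x: "v < x" "x < w"
  then have "x > 0" using assms sonic_nonneg by linarith
  have "(exp (\<Phi> x) - 1 / x) * \<Phi>' x > 0"
    using x assms k_sign(2)[OF \<open>x > 0\<close>] by (intro mult_neg_neg potential_deriv_neg) auto
  then show "\<exists>y. (E has_real_derivative y) (at x) \<and> 0 < y"
    using energy_has_deriv[OF \<open>x > 0\<close>] by blast
next
  show "continuous_on {v..w} E"
    using assms(1) sonic_nonneg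
    by (intro continuous_at_imp_continuous_on ballI DERIV_isCont[OF energy_has_deriv]) auto
qed

lemma energy_strict_antimono:
  assumes "v\<^sub>s < v" "v < w" and pos: "\<And>x. v < x \<Longrightarrow> x < w \<Longrightarrow> k x > 0"
  shows "E w < E v"
proof (rule DERIV_neg_imp_decreasing_open[OF \<open>v < w\<close>])
  fix x assume x: "v < x" "x < w"
  then have "x > 0" using assms sonic_nonneg by linarith
  have "(exp (\<Phi> x) - 1 / x) * \<Phi>' x < 0"
    using x assms k_sign(1)[OF \<open>x > 0\<close>] by (intro mult_pos_neg potential_deriv_neg) auto
  then show "\<exists>y. (E has_real_derivative y) (at x) \<and> y < 0"
    using energy_has_deriv[OF \<open>x > 0\<close>] by blast
next
  show "continuous_on {v..w} E"
    using assms(1) sonic_nonneg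
    by (intro continuous_at_imp_continuous_on ballI DERIV_isCont[OF energy_has_deriv]) auto
qed

text \<open>Let \<open>r1\<close> be the zero of \<open>k\<close> below 1. From its negative value
  near \<open>v\<^sub>s\<close> the energy increases strictly up to \<open>r1\<close>, then
  decreases strictly to \<open>E 1 = 0\<close>. It is therefore positive at \<open>r1\<close>, and
  its only zero before 1 lies on the rising branch. There \<open>k r < 0\<close>, which says that
  the zero is simple.\<close>

lemma turning_point_exists:
  "\<exists>r. v\<^sub>s < r \<and> r < 1 \<and> E r = 0 \<and> k r < 0 \<and>
     (\<forall>v. v\<^sub>s < v \<and> v < r \<longrightarrow> E v < 0) \<and> (\<forall>v. r < v \<and> v < 1 \<longrightarrow> 0 < E v)"
proof -
  \<comment> \<open>The point \<open>a\<close> just right of \<open>v\<^sub>s\<close> replaces the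
    sonic value itself, at which \<open>\<Phi>\<close> and \<open>E\<close> need not be
    differentiable.\<close>
  have "\<forall>\<^sub>F v in at v\<^sub>s. E v < 0"
    using order_tendstoD(2)[OF isCont_energy_sonic[unfolded isCont_def] sonic] .
  then have "\<forall>\<^sub>F v in at_right v\<^sub>s. E v < 0"
    by (rule filter_leD[rotated]) (simp add: at_le)
  moreover have "\<forall>\<^sub>F v in at_right v\<^sub>s. v \<in> {v\<^sub>s<..<1}"
    using eventually_at_right_real[OF sonic_less_1] .
  ultimately have "\<exists>a. E a < 0 \<and> a \<in> {v\<^sub>s<..<1}"
    by (rule eventually_happens'[OF trivial_limit_at_right_real, OF eventually_conj])
  then obtain a where a: "v\<^sub>s < a" "a < 1" "E a < 0" by auto
  then have "0 < a" using sonic_nonneg by linarith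
  have k_pos: "k v > 0" if "k_max \<le> v" "v < 1" for v
    using k_strict_antimono[OF that] by simp
  \<comment> \<open>Otherwise \<open>k\<close>, which rises up to \<open>k_max\<close> and then
    falls to 0 at 1, would be positive on all of \<open>(a, 1)\<close>, and the energy would
    decrease from \<open>E a < 0\<close> to \<open>E 1 = 0\<close>.\<close>
  have "k a < 0"
  proof (rule ccontr)
    assume "\<not> k a < 0"
    have "k v > 0" if v: "a < v" "v < 1" for v
      using k_pos[of v] k_strict_mono[of a v] v \<open>0 < a\<close> \<open>\<not> k a < 0\<close> by fastforce
    then have "E 1 < E a" using a by (intro energy_strict_antimono) auto
    with a show False by simp
  qed
  then have "a < k_max" using k_pos[of a] a by fastforce
  have "\<exists>r\<ge>a. r \<le> k_max \<and> k r = 0"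
    using \<open>a < k_max\<close> \<open>k a < 0\<close> k_pos[of k_max] k_max \<open>0 < a\<close>
    by (intro IVT) (auto intro!: DERIV_isCont[OF k_has_deriv])
  then obtain r1 where r1: "a \<le> r1" "r1 \<le> k_max" "k r1 = 0" by blast
  then have "a < r1" using \<open>k a < 0\<close> by (cases "a = r1") auto
  have "r1 < 1" using r1 k_max by linarith
  have neg: "k v < 0" if "0 < v" "v < r1" for v
    using k_strict_mono[of v r1] that r1 by simp
  have pos: "k v > 0" if "r1 < v" "v < 1" for v
    using k_pos[of v] k_strict_mono[of r1 v] that r1 \<open>0 < a\<close> by fastforce
  have E_pos: "E v > 0" if "r1 \<le> v" "v < 1" for v
    using energy_strict_antimono[of v 1] that pos a \<open>a < r1\<close> by force
  have "\<exists>r\<ge>a. r \<le> r1 \<and> E r = 0"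
    using \<open>a < r1\<close> \<open>r1 < 1\<close> E_pos[of r1] a \<open>0 < a\<close>
    by (intro IVT) (auto intro!: DERIV_isCont[OF energy_has_deriv])
  then obtain r where r: "a \<le> r" "r \<le> r1" "E r = 0" by blast
  then have "r < r1" using E_pos[of r1] \<open>r1 < 1\<close> by (cases "r = r1") auto
  have mono: "E v < E w" if "v\<^sub>s < v" "v < w" "w \<le> r1" for v w
    using that neg sonic_nonneg by (intro energy_strict_mono) auto
  have "E v < 0" if "v\<^sub>s < v" "v < r" for v
    using mono[of v r] that r by simp
  moreover have "E v > 0" if "r < v" "v < 1" for v
    using mono[of r v] E_pos[of v] that r a by fastforce
  moreover have "v\<^sub>s < r" "r < 1" "k r < 0"
    using a r \<open>r < r1\<close> \<open>r1 < 1\<close> neg[of r] \<open>0 < a\<close> by auto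
  ultimately show ?thesis using r by blast
qed

definition v\<^sub>0 :: real where
  "v\<^sub>0 = (SOME r. v\<^sub>s < r \<and> r < 1 \<and> E r = 0 \<and> k r < 0 \<and>
     (\<forall>v. v\<^sub>s < v \<and> v < r \<longrightarrow> E v < 0) \<and> (\<forall>v. r < v \<and> v < 1 \<longrightarrow> 0 < E v))"

lemma v\<^sub>0:
  shows sonic_less_v\<^sub>0: "v\<^sub>s < v\<^sub>0" and v\<^sub>0_less_1: "v\<^sub>0 < 1" and energy_v\<^sub>0: "E v\<^sub>0 = 0"
    and k_v\<^sub>0: "k v\<^sub>0 < 0" and energy_neg: "\<And>v. v\<^sub>s < v \<Longrightarrow> v < v\<^sub>0 \<Longrightarrow> E v < 0"
    and energy_pos: "\<And>v. v\<^sub>0 < v \<Longrightarrow> v < 1 \<Longrightarrow> 0 < E v"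
  using someI_ex[OF turning_point_exists] unfolding v\<^sub>0_def[symmetric] by blast+

lemma v\<^sub>0_pos: "0 < v\<^sub>0"
  using sonic_nonneg sonic_less_v\<^sub>0 by linarith

section \<open>Quantitative bounds on the potential and the energy\<close>

lemma potential_strict_antimono:
  assumes "v\<^sub>s < v" "v < w"
  shows "\<Phi> w < \<Phi> v"
proof (rule DERIV_neg_imp_decreasing[OF \<open>v < w\<close>])
  fix x assume "v \<le> x" "x \<le> w"
  then have "v\<^sub>s < x" "0 < x" using assms sonic_nonneg by linarith+
  then show "\<exists>y. (\<Phi> has_real_derivative y) (at x) \<and> y < 0"
    using potential_has_deriv potential_deriv_neg by blast
qed

lemma potential_deriv_le:
  assumes "v\<^sub>0 \<le> v"
  shows "\<Phi>' v \<le> \<Phi>' v\<^sub>0"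
  unfolding potential_deriv_def using assms v\<^sub>0_pos \<sigma> c
  by (intro diff_mono divide_left_mono mult_left_mono) auto

text \<open>Read backwards, this is a Lipschitz bound for \<open>v\<close> as a function of \<phi>.
  It rests on \<open>\<Phi>'\<close> being decreasing, so that its modulus beyond
  \<open>v\<^sub>0\<close> is smallest at \<open>v\<^sub>0\<close>, where it is still
  nonzero.\<close>

lemma potential_expanding:
  assumes "v\<^sub>0 \<le> p" "v\<^sub>0 \<le> q"
  shows "- \<Phi>' v\<^sub>0 * \<bar>p - q\<bar> \<le> \<bar>\<Phi> p - \<Phi> q\<bar>"
proof -
  have *: "- \<Phi>' v\<^sub>0 * \<bar>p - q\<bar> \<le> \<bar>\<Phi> p - \<Phi> q\<bar>" if "v\<^sub>0 \<le> p" "p < q" for p q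
  proof -
    have "\<exists>x>p. x < q \<and> \<Phi> q - \<Phi> p = (q - p) * \<Phi>' x"
      using that v\<^sub>0_pos by (intro MVT2 potential_has_deriv) auto
    then obtain x where x: "p < x" "x < q" "\<Phi> q - \<Phi> p = (q - p) * \<Phi>' x" by blast
    have "(q - p) * \<Phi>' x \<le> (q - p) * \<Phi>' v\<^sub>0"
      using x that by (intro mult_left_mono potential_deriv_le) auto
    with x that show ?thesis by (simp add: algebra_simps)
  qed
  show ?thesis
    using *[of p q] *[of q p] assms
    by (cases p q rule: linorder_cases) (auto simp: abs_minus_commute)
qed

text \<open>Both \<open>E\<close> and the factor \<open>h\<close> of its derivative vanish at 1, so
  applying the mean value theorem to each gives one factor \<open>1 - v\<close>. The quadratic bound
  is what later makes the approach to the rest state take infinite time.\<close>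

lemma energy_le_square:
  "\<exists>C. \<forall>v. v\<^sub>0 \<le> v \<and> v < 1 \<longrightarrow> E v \<le> C * (1 - v)\<^sup>2"
proof -
  define h where "h v = exp (\<Phi> v) - 1 / v" for v
  define h' where "h' v = exp (\<Phi> v) * \<Phi>' v + 1 / v\<^sup>2" for v
  have h: "(h has_real_derivative h' v) (at v)" if "v > 0" for v
    unfolding h_def h'_def using that
    by (auto intro!: derivative_eq_intros potential_has_deriv simp: power2_eq_square)
  have "continuous_on {v\<^sub>0..1} h'" "continuous_on {v\<^sub>0..1} \<Phi>'"
    unfolding h'_def potential_def potential_deriv_def using v\<^sub>0_pos
    by (auto intro!: continuous_intros)
  then have "bounded (h' ` {v\<^sub>0..1})" "bounded (\<Phi>' ` {v\<^sub>0..1})"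
    by (auto intro!: compact_imp_bounded compact_continuous_image)
  then obtain M N where M: "\<forall>v \<in> {v\<^sub>0..1}. \<bar>h' v\<bar> \<le> M" and N: "\<forall>v \<in> {v\<^sub>0..1}. \<bar>\<Phi>' v\<bar> \<le> N"
    by (auto simp: bounded_iff)
  have h_le: "\<bar>h v\<bar> \<le> M * (1 - v)" if v: "v\<^sub>0 \<le> v" "v < 1" for v
  proof -
    obtain x where x: "v < x" "x < 1" "h 1 - h v = (1 - v) * h' x"
      using MVT2[OF \<open>v < 1\<close>, of h h'] h v v\<^sub>0_pos by auto
    then have "\<bar>h v\<bar> = \<bar>h' x\<bar> * (1 - v)" using v by (simp add: h_def abs_mult abs_minus_commute)
    also have "\<dots> \<le> M * (1 - v)" using M x v by (intro mult_right_mono) auto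
    finally show ?thesis .
  qed
  have "E v \<le> M * N * (1 - v)\<^sup>2" if v: "v\<^sub>0 \<le> v" "v < 1" for v
  proof -
    have "\<exists>x>v. x < 1 \<and> E 1 - E v = (1 - v) * (h x * \<Phi>' x)"
      unfolding h_def using v v\<^sub>0_pos energy_has_deriv by (intro MVT2) auto
    then obtain x where x: "v < x" "x < 1" "E 1 - E v = (1 - v) * (h x * \<Phi>' x)" by blast
    then have "E v \<le> (1 - v) * (\<bar>h x\<bar> * \<bar>\<Phi>' x\<bar>)"
      using v abs_ge_minus_self[of "(1 - v) * (h x * \<Phi>' x)"] by (simp add: abs_mult)
    also have "\<dots> \<le> (1 - v) * (M * (1 - v) * N)"
    proof (intro mult_left_mono mult_mono)
      have "M \<ge> 0" using M x v order_trans[OF abs_ge_zero, of "h' x" M] by auto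
      then show "0 \<le> M * (1 - v)" using v by simp
      have "M * (1 - x) \<le> M * (1 - v)" using \<open>M \<ge> 0\<close> x by (intro mult_left_mono) auto
      then show "\<bar>h x\<bar> \<le> M * (1 - v)" using h_le[of x] x v by simp
      show "\<bar>\<Phi>' x\<bar> \<le> N" using N x v by simp
    qed (use v in auto)
    finally show ?thesis by (simp add: power2_eq_square mult_ac)
  qed
  then show ?thesis by blast
qed

end

section \<open>Reduction and uniqueness of solutions\<close>

lemma const_eq_limit_at_infinity:
  fixes f :: "real \<Rightarrow> real"
  assumes "\<And>x. (f has_real_derivative 0) (at x)" and "(f \<longlongrightarrow> l) at_infinity"
  shows "f x = l"
proof -
  have "f = (\<lambda>_. f x)"
    using assms(1) DERIV_isconst_all by blast
  with assms(2) have "((\<lambda>_::real. f x) \<longlongrightarrow> l) at_infinity" by simp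
  then show ?thesis
    by (simp add: tendsto_const_iff trivial_limit_at_infinity)
qed

lemma attains_max_at_infinity_0:
  fixes f :: "real \<Rightarrow> real"
  assumes cont: "\<And>x. isCont f x" and lim: "(f \<longlongrightarrow> 0) at_infinity" and "f a > 0"
  obtains m where "\<And>x. f x \<le> f m"
proof -
  obtain B where B: "\<And>x. B \<le> \<bar>x\<bar> \<Longrightarrow> f x < f a"
    using order_tendstoD(2)[OF lim \<open>f a > 0\<close>] by (auto simp: eventually_at_infinity)
  define r where "r = max B \<bar>a\<bar>"
  have "\<exists>m\<in>{-r..r}. \<forall>x\<in>{-r..r}. f x \<le> f m"
    by (rule continuous_attains_sup) (auto simp: r_def intro!: continuous_at_imp_continuous_on cont)
  then obtain m where m: "\<And>x. x \<in> {-r..r} \<Longrightarrow> f x \<le> f m" by blast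
  have "f x \<le> f m" for x
  proof (cases "x \<in> {-r..r}")
    case False
    then have "B \<le> \<bar>x\<bar>" by (auto simp: r_def)
    then have "f x < f a" by (rule B)
    also have "f a \<le> f m" by (rule m) (auto simp: r_def)
    finally show ?thesis by simp
  qed (rule m)
  then show thesis by (rule that)
qed

text \<open>On each interval from \<open>m\<close> to \<open>m + 1\<close> the mean value theorem
  yields a point where \<open>f'\<close> equals an increment of \<open>f\<close>. These increments
  tend to 0, so a limit of the squared derivative, once known to exist, can only be 0.\<close>

lemma deriv_square_limit_0:
  fixes f :: "real \<Rightarrow> real"
  assumes f: "\<And>x. (f has_real_derivative f' x) (at x)"
    and lim: "(f \<longlongrightarrow> l) at_infinity" and sq: "((\<lambda>x. (f' x)\<^sup>2) \<longlongrightarrow> K) at_infinity"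
  shows "K = 0"
proof -
  have "\<exists>t>real m. t < real m + 1 \<and> f (real m + 1) - f (real m) = (real m + 1 - real m) * f' t" for m
    using f by (intro MVT2) auto
  then have "\<exists>t>real m. f' t = f (real m + 1) - f (real m)" for m
    by fastforce
  then obtain t where t: "\<And>m. t m > real m" "\<And>m. f' (t m) = f (real m + 1) - f (real m)"
    by metis
  have inf: "filterlim (\<lambda>m. real m) at_infinity sequentially"
    "filterlim (\<lambda>m. real m + 1) at_infinity sequentially" "filterlim t at_infinity sequentially"
    using t(1)
    by (auto intro!: filterlim_at_top_imp_at_infinity filterlim_real_sequentially
        filterlim_at_top_mono[OF filterlim_real_sequentially] always_eventually less_imp_le)
  have "(\<lambda>m. f (real m + 1) - f (real m)) \<longlonglongrightarrow> l - l"
    by (intro tendsto_diff filterlim_compose[OF lim] inf)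
  then have "(\<lambda>m. (f' (t m))\<^sup>2) \<longlonglongrightarrow> 0\<^sup>2"
    by (intro tendsto_power) (simp add: t)
  moreover have "(\<lambda>m. (f' (t m))\<^sup>2) \<longlonglongrightarrow> K"
    using filterlim_compose[OF sq inf(3)] .
  ultimately show ?thesis
    by (simp add: LIMSEQ_unique)
qed

locale traveling_wave = supersonic +
  fixes \<epsilon> :: real
  assumes \<epsilon>: "\<epsilon> > 0"
begin

lemma solution_derivs:
  assumes "tw_solution \<sigma> c \<epsilon> n u \<phi>"
  shows "n x > 0" and "(n has_real_derivative deriv n x) (at x)"
    and "(u has_real_derivative deriv u x) (at x)"
    and "(\<phi> has_real_derivative deriv \<phi> x) (at x)"
    and "(deriv \<phi> has_real_derivative (exp (\<phi> x) - n x) / \<epsilon>) (at x)"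
proof -
  note tw = assms[unfolded tw_solution_def]
  have "\<epsilon> * deriv (deriv \<phi>) x = exp (\<phi> x) - n x" using tw by blast
  then have "deriv (deriv \<phi>) x = (exp (\<phi> x) - n x) / \<epsilon>"
    using \<epsilon> by (simp add: field_simps)
  then show "(deriv \<phi> has_real_derivative (exp (\<phi> x) - n x) / \<epsilon>) (at x)"
    using tw smooth_fun_has_deriv(2)[of \<phi> x] by metis
qed (use assms in \<open>auto simp: tw_solution_def intro: smooth_fun_has_deriv\<close>)

lemma solution_reduction:
  assumes tw: "tw_solution \<sigma> c \<epsilon> n u \<phi>"
  shows "u x = c * (1 - 1 / n x)" and "\<phi> x = \<Phi> (1 / n x)"
    and "\<epsilon> / 2 * (deriv \<phi> x)\<^sup>2 = E (1 / n x)"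
proof -
  note n_pos = solution_derivs(1)[OF tw] and n = solution_derivs(2)[OF tw]
    and u = solution_derivs(3)[OF tw] and \<phi> = solution_derivs(4,5)[OF tw]
  have mass: "- c * deriv n x + deriv (\<lambda>y. n y * u y) x = 0"
    and momentum: "- c * deriv u x + u x * deriv u x + \<sigma> * deriv n x / n x = - deriv \<phi> x" for x
    using tw by (auto simp: tw_solution_def)
  have lim: "(n \<longlongrightarrow> 1) at_infinity" "(u \<longlongrightarrow> 0) at_infinity" "(\<phi> \<longlongrightarrow> 0) at_infinity"
    using tw by (auto simp: tw_solution_def)
  have u_eq: "u x = c * (1 - 1 / n x)" for x
  proof -
    have "n x * u x - c * n x = 1 * 0 - c * 1"
    proof (rule const_eq_limit_at_infinity[where f = "\<lambda>x. n x * u x - c * n x"])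
      fix x
      have "((\<lambda>y. n y * u y) has_real_derivative deriv n x * u x + deriv u x * n x) (at x)"
        using n u by (rule DERIV_mult)
      with mass[of x] have "((\<lambda>y. n y * u y) has_real_derivative c * deriv n x) (at x)"
        using DERIV_imp_deriv by fastforce
      from DERIV_diff[OF this DERIV_cmult[OF n, of c]]
      show "((\<lambda>y. n y * u y - c * n y) has_real_derivative 0) (at x)"
        by simp
    qed (intro tendsto_intros lim)
    then show ?thesis using n_pos[of x] by (simp add: field_simps)
  qed
  \<comment> \<open>Bernoulli's law: the momentum equation is the derivative of
    \<open>\<phi> - c * u + u\<^sup>2 / 2 + \<sigma> * ln n\<close>, and inserting the formula for
    \<open>u\<close> turns the conserved quantity into \<open>\<Phi>\<close>.\<close>
  have \<phi>_eq: "\<phi> x = \<Phi> (1 / n x)" for x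
  proof -
    have "\<phi> x - c * u x + (u x)\<^sup>2 / 2 + \<sigma> * ln (n x) = 0 - c * 0 + 0\<^sup>2 / 2 + \<sigma> * ln 1"
    proof (rule const_eq_limit_at_infinity
        [where f = "\<lambda>x. \<phi> x - c * u x + (u x)\<^sup>2 / 2 + \<sigma> * ln (n x)"])
      fix x
      have "((\<lambda>x. \<phi> x - c * u x + (u x)\<^sup>2 / 2 + \<sigma> * ln (n x)) has_real_derivative
          deriv \<phi> x - c * deriv u x + u x * deriv u x + \<sigma> * (deriv n x / n x)) (at x)"
        using n_pos[of x] by (auto intro!: derivative_eq_intros n u \<phi>)
      moreover have "deriv \<phi> x - c * deriv u x + u x * deriv u x + \<sigma> * (deriv n x / n x) = 0"
        using momentum[of x] by simp
      ultimately show "((\<lambda>x. \<phi> x - c * u x + (u x)\<^sup>2 / 2 + \<sigma> * ln (n x)) has_real_derivative 0) (at x)"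
        by simp
    qed (intro tendsto_intros lim, simp_all)
    moreover have "ln (1 / n x) = - ln (n x)" using n_pos[of x] by (simp add: ln_div)
    moreover have "c * u x - (u x)\<^sup>2 / 2 = c\<^sup>2 / 2 * (1 - (1 / n x)\<^sup>2)"
    proof -
      have "c * (c * (1 - w)) - (c * (1 - w))\<^sup>2 / 2 = c\<^sup>2 / 2 * (1 - w\<^sup>2)" for w
        by (simp add: power2_eq_square field_simps)
      then show ?thesis by (simp only: u_eq)
    qed
    ultimately show ?thesis unfolding potential_def by simp
  qed
  have v_pos: "1 / n x > 0" for x using n_pos[of x] by simp
  have E_deriv: "((\<lambda>x. E (1 / n x)) has_real_derivative (exp (\<phi> x) - n x) * deriv \<phi> x) (at x)" for x
  proof -
    have v: "((\<lambda>x. 1 / n x) has_real_derivative - deriv n x / (n x)\<^sup>2) (at x)"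
      using n_pos[of x] by (auto intro!: derivative_eq_intros n simp: power2_eq_square)
    have "((\<lambda>x. \<Phi> (1 / n x)) has_real_derivative \<Phi>' (1 / n x) * (- deriv n x / (n x)\<^sup>2)) (at x)"
      using DERIV_chain2[OF potential_has_deriv[OF v_pos] v] .
    then have "deriv \<phi> x = \<Phi>' (1 / n x) * (- deriv n x / (n x)\<^sup>2)"
      using \<phi>(1)[of x] DERIV_unique by (simp add: \<phi>_eq[abs_def])
    with DERIV_chain2[OF energy_has_deriv[OF v_pos] v] show ?thesis
      by (simp add: \<phi>_eq mult.assoc)
  qed
  have const: "((\<lambda>x. \<epsilon> / 2 * (deriv \<phi> x)\<^sup>2 - E (1 / n x)) has_real_derivative 0) (at x)" for x
  proof -
    have "((\<lambda>x. \<epsilon> / 2 * (deriv \<phi> x)\<^sup>2 - E (1 / n x)) has_real_derivative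
        deriv \<phi> x * (\<epsilon> * ((exp (\<phi> x) - n x) / \<epsilon>)) - (exp (\<phi> x) - n x) * deriv \<phi> x) (at x)"
      by (auto intro!: derivative_eq_intros \<phi> E_deriv)
    then show ?thesis using \<epsilon> by simp
  qed
  \<comment> \<open>The far-field condition says nothing about \<phi>'. But \<open>n\<close> tends
    to 1, so the conservation law forces the square of \<phi>' to converge; its limit must be 0, and
    \<open>E 1 = 0\<close> then gives \<open>K = 0\<close>.\<close>
  obtain K where K: "\<And>x. \<epsilon> / 2 * (deriv \<phi> x)\<^sup>2 - E (1 / n x) = K"
    using DERIV_isconst_all[of "\<lambda>x. \<epsilon> / 2 * (deriv \<phi> x)\<^sup>2 - E (1 / n x)" _ 0] const by blast
  then have "(deriv \<phi> x)\<^sup>2 = 2 / \<epsilon> * (K + E (1 / n x))" for x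
    using \<epsilon> K[of x, symmetric] by simp
  moreover have "((\<lambda>x. 2 / \<epsilon> * (K + E (1 / n x))) \<longlongrightarrow> 2 / \<epsilon> * (K + E (1 / 1))) at_infinity"
    by (intro tendsto_intros isCont_tendsto_compose[OF DERIV_isCont[OF energy_has_deriv]] lim) auto
  ultimately have "((\<lambda>x. (deriv \<phi> x)\<^sup>2) \<longlongrightarrow> 2 / \<epsilon> * (K + E (1 / 1))) at_infinity"
    by (simp only:)
  then have "2 / \<epsilon> * (K + E (1 / 1)) = 0"
    by (rule deriv_square_limit_0[OF \<phi>(1) lim(3)])
  then have "K = 0" using \<epsilon> by simp
  with K[of x] show "\<epsilon> / 2 * (deriv \<phi> x)\<^sup>2 = E (1 / n x)" by simp
  show "u x = c * (1 - 1 / n x)" "\<phi> x = \<Phi> (1 / n x)" by (fact u_eq \<phi>_eq)+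
qed

text \<open>Along a solution the energy is nonnegative. By continuity from the far field,
  \<open>v\<close> cannot cross the sonic value, and the energy is negative between there and
  \<open>v\<^sub>0\<close>. If \<open>v\<close> exceeded 1 somewhere, \<phi> would attain a negative
  minimum; the energy would vanish at that point although it increases strictly from 0 beyond
  1.\<close>

lemma solution_bounds:
  assumes tw: "tw_solution \<sigma> c \<epsilon> n u \<phi>"
  shows "v\<^sub>0 \<le> 1 / n x" "1 / n x \<le> 1"
proof -
  note red = solution_reduction[OF tw]
  note n_pos = solution_derivs(1)[OF tw] and n = solution_derivs(2)[OF tw]
    and \<phi> = solution_derivs(4)[OF tw]
  have lim: "(n \<longlongrightarrow> 1) at_infinity" "(\<phi> \<longlongrightarrow> 0) at_infinity"
    using tw by (auto simp: tw_solution_def)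
  define v where "v x = 1 / n x" for x
  have cont: "isCont v x" for x
    unfolding v_def using n_pos[of x] DERIV_isCont[OF n] by (intro continuous_intros) auto
  have E_nonneg: "0 \<le> E (v x)" for x
    unfolding v_def red(3)[symmetric] using \<epsilon> by simp
  have "(v \<longlongrightarrow> 1 / 1) at_infinity"
    unfolding v_def by (intro tendsto_intros lim) auto
  then have "\<forall>\<^sub>F x in at_infinity. v\<^sub>s < v x"
    using sonic_less_1 by (intro order_tendstoD(1)[where y = 1]) auto
  then obtain b where b: "v\<^sub>s < v b"
    using eventually_happens'[OF trivial_limit_at_infinity] by blast
  have "v\<^sub>s < v x" for x
  proof (rule ccontr)
    assume "\<not> v\<^sub>s < v x"
    then have "\<exists>z. v z = v\<^sub>s"
      using b IVT[of v x "v\<^sub>s" b] IVT2[of v x "v\<^sub>s" b] cont by (cases "x \<le> b") force+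
    with E_nonneg sonic show False by (metis not_less)
  qed
  then show "v\<^sub>0 \<le> 1 / n x"
    using E_nonneg[of x] energy_neg[of "v x"] by (fastforce simp: v_def)
  show "1 / n x \<le> 1"
  proof (rule ccontr)
    assume "\<not> 1 / n x \<le> 1"
    then have "- \<phi> x > 0"
      using potential_strict_antimono[of 1 "1 / n x"] sonic_less_1 by (simp add: red(2))
    moreover have "isCont (\<lambda>x. - \<phi> x) y" for y
      by (intro continuous_minus DERIV_isCont[OF \<phi>])
    moreover have "((\<lambda>x. - \<phi> x) \<longlongrightarrow> 0) at_infinity"
      using tendsto_minus[OF lim(2)] by simp
    ultimately obtain m where m: "\<And>y. - \<phi> y \<le> - \<phi> m"
      using attains_max_at_infinity_0[of "\<lambda>x. - \<phi> x" x] by blast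
    have "deriv \<phi> m = 0"
      using DERIV_local_min[OF \<phi>, of 1 m] m by simp
    then have "E (v m) = 0" using red(3)[of m] by (simp add: v_def)
    have "\<Phi> (v m) < 0" using m[of x] \<open>- \<phi> x > 0\<close> red(2)[of m] by (simp add: v_def)
    then have "1 < v m"
      using potential_strict_antimono[of "v m" 1] \<open>\<And>x. v\<^sub>s < v x\<close> by (cases "v m" "1::real" rule: linorder_cases) force+
    then have "E 1 < E (v m)"
      using k_strict_antimono[of 1] k_max sonic_less_1 by (intro energy_strict_mono) auto
    with \<open>E (v m) = 0\<close> show False by simp
  qed
qed

text \<open>At a positive maximum of \<phi> the derivative and hence the energy vanish. Within the
  bounds on \<open>v\<close> this leaves only \<open>v\<^sub>0\<close> and 1, and the value 1 would
  give \<phi> = 0.\<close>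

lemma solution_crest:
  assumes tw: "tw_solution \<sigma> c \<epsilon> n u \<phi>" and "nontrivial n u \<phi>"
  obtains m where "1 / n m = v\<^sub>0" "deriv \<phi> m = 0"
proof -
  note red = solution_reduction[OF tw] and bd = solution_bounds[OF tw]
    and \<phi> = solution_derivs(4)[OF tw]
  obtain x where "n x \<noteq> 1"
    using \<open>nontrivial n u \<phi>\<close> red(1,2) by (fastforce simp: nontrivial_def)
  then have "1 / n x < 1" using bd(2)[of x] by (simp add: order_less_le)
  then have "\<phi> x > 0"
    using potential_strict_antimono[of "1 / n x" 1] bd(1)[of x] sonic_less_v\<^sub>0 by (simp add: red(2))
  then obtain m where m: "\<And>y. \<phi> y \<le> \<phi> m"
    using attains_max_at_infinity_0[of \<phi> x] \<phi> tw by (auto simp: tw_solution_def intro!: DERIV_isCont)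
  have d: "deriv \<phi> m = 0"
    using DERIV_local_max[OF \<phi>, of 1 m] m by simp
  have "\<phi> m > 0" using m[of x] \<open>\<phi> x > 0\<close> by simp
  then have "1 / n m \<noteq> 1" using red(2)[of m] by auto
  moreover have "E (1 / n m) = 0" using red(3)[of m] d by simp
  ultimately have "1 / n m = v\<^sub>0"
    using bd[of m] energy_pos[of "1 / n m"] by (fastforce simp: order_less_le)
  with d show thesis by (intro that)
qed

text \<open>Poisson's equation becomes an equation for \<phi> alone only if \<open>n\<close> is a
  Lipschitz function of \<phi>. The bound \<open>v\<^sub>0 \<le> v\<close> guarantees this by
  keeping both solutions away from the sonic value; the shift \<open>d\<close> aligns the two
  crests.\<close>

lemma solution_unique:
  assumes tw1: "tw_solution \<sigma> c \<epsilon> n1 u1 \<phi>1" "nontrivial n1 u1 \<phi>1"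
    and tw2: "tw_solution \<sigma> c \<epsilon> n2 u2 \<phi>2" "nontrivial n2 u2 \<phi>2"
  shows "\<exists>xc. \<forall>x. n2 x = n1 (x - xc) \<and> u2 x = u1 (x - xc) \<and> \<phi>2 x = \<phi>1 (x - xc)"
proof -
  note red1 = solution_reduction[OF tw1(1)] and bd1 = solution_bounds[OF tw1(1)]
  note red2 = solution_reduction[OF tw2(1)] and bd2 = solution_bounds[OF tw2(1)]
  obtain m1 where m1: "1 / n1 m1 = v\<^sub>0" "deriv \<phi>1 m1 = 0" using tw1 by (rule solution_crest)
  obtain m2 where m2: "1 / n2 m2 = v\<^sub>0" "deriv \<phi>2 m2 = 0" using tw2 by (rule solution_crest)
  define d where "d = m2 - m1"
  define K where "K = - \<Phi>' v\<^sub>0"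
  have "K > 0" using potential_deriv_neg[OF sonic_less_v\<^sub>0] by (simp add: K_def)
  note P1 = solution_derivs(5,4,1)[OF tw1(1)] and P2 = solution_derivs(5,4,1)[OF tw2(1)]
  have v_diff: "K * \<bar>1 / n1 x - 1 / n2 y\<bar> \<le> \<bar>\<phi>1 x - \<phi>2 y\<bar>" for x y
    unfolding K_def red1(2) red2(2) by (rule potential_expanding[OF bd1(1) bd2(1)])
  have n_le: "n1 x \<le> 1 / v\<^sub>0" "n2 x \<le> 1 / v\<^sub>0" for x
    using bd1(1)[of x] bd2(1)[of x] P1(3)[of x] P2(3)[of x] v\<^sub>0_pos by (auto simp: field_simps)
  \<comment> \<open>The difference of the densities is their product times the difference of the
    reciprocals; the densities are at most \<open>1 / v\<^sub>0\<close>, and \<open>v_diff\<close>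
    controls the reciprocals.\<close>
  have n_diff: "\<bar>n1 x - n2 y\<bar> \<le> 1 / v\<^sub>0\<^sup>2 / K * \<bar>\<phi>1 x - \<phi>2 y\<bar>" for x y
  proof -
    have "\<bar>n1 x - n2 y\<bar> = n1 x * n2 y * \<bar>1 / n1 x - 1 / n2 y\<bar>"
    proof -
      have "n1 x - n2 y = - (n1 x * n2 y * (1 / n1 x - 1 / n2 y))"
        using P1(3)[of x] P2(3)[of y] by (simp add: right_diff_distrib)
      then show ?thesis
        using P1(3)[of x] P2(3)[of y] by (metis abs_minus_cancel abs_mult abs_of_pos)
    qed
    also have "\<dots> \<le> (1 / v\<^sub>0) * (1 / v\<^sub>0) * (\<bar>\<phi>1 x - \<phi>2 y\<bar> / K)"
      using v_diff[of x y] \<open>K > 0\<close> n_le P1(3)[of x] P2(3)[of y] v\<^sub>0_pos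
      by (intro mult_mono) (auto simp: pos_le_divide_eq mult.commute)
    finally show ?thesis by (simp add: power2_eq_square)
  qed
  have exp_diff: "\<bar>exp (\<phi>1 x) - exp (\<phi>2 y)\<bar> \<le> exp (\<Phi> v\<^sub>0) * \<bar>\<phi>1 x - \<phi>2 y\<bar>" for x y
  proof -
    have le: "\<Phi> v \<le> \<Phi> v\<^sub>0" if "v\<^sub>0 \<le> v" for v
      using potential_strict_antimono[OF sonic_less_v\<^sub>0, of v] that by (cases "v = v\<^sub>0") auto
    have *: "\<bar>exp a - exp b\<bar> \<le> exp (\<Phi> v\<^sub>0) * \<bar>a - b\<bar>" if "a < b" "b \<le> \<Phi> v\<^sub>0" for a b :: real
    proof -
      have "\<exists>z>a. z < b \<and> exp b - exp a = (b - a) * exp z"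
        using \<open>a < b\<close> by (intro MVT2) (auto intro: DERIV_exp)
      then obtain z where z: "a < z" "z < b" "exp b - exp a = (b - a) * exp z" by blast
      have "(b - a) * exp z \<le> (b - a) * exp (\<Phi> v\<^sub>0)" using z that by (intro mult_left_mono) auto
      then show ?thesis using z that by (simp add: abs_if mult.commute)
    qed
    show ?thesis
      unfolding red1(2) red2(2)
      using *[of "\<Phi> (1 / n1 x)" "\<Phi> (1 / n2 y)"] *[of "\<Phi> (1 / n2 y)" "\<Phi> (1 / n1 x)"]
        le[OF bd1(1)[of x]] le[OF bd2(1)[of y]]
      by (cases "\<Phi> (1 / n1 x)" "\<Phi> (1 / n2 y)" rule: linorder_cases) (auto simp: abs_minus_commute)
  qed
  define L where "L = (exp (\<Phi> v\<^sub>0) + 1 / v\<^sub>0\<^sup>2 / K) / \<epsilon>"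
  have shift: "((\<lambda>x. f (x - d)) has_real_derivative f' (x - d)) (at x)"
    if "\<And>x. (f has_real_derivative f' x) (at x)" for f f' :: "real \<Rightarrow> real" and x
  proof -
    have "((\<lambda>x. x - d) has_real_derivative 1) (at x)" by (auto intro!: derivative_eq_intros)
    from DERIV_chain2[OF that this] show ?thesis by simp
  qed
  have eq: "\<phi>1 (x - d) = \<phi>2 x" for x
  proof (rule second_order_ode_unique[where f = "\<lambda>x. \<phi>1 (x - d)" and g = \<phi>2 and a = m2])
    show "((\<lambda>x. \<phi>1 (x - d)) has_real_derivative deriv \<phi>1 (x - d)) (at x)"
      "((\<lambda>x. deriv \<phi>1 (x - d)) has_real_derivative (exp (\<phi>1 (x - d)) - n1 (x - d)) / \<epsilon>) (at x)" for x
      using P1 by (auto intro!: shift)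
    show "(\<phi>2 has_real_derivative deriv \<phi>2 x) (at x)"
      "(deriv \<phi>2 has_real_derivative (exp (\<phi>2 x) - n2 x) / \<epsilon>) (at x)" for x
      using P2 by auto
    show "\<phi>1 (m2 - d) = \<phi>2 m2" "deriv \<phi>1 (m2 - d) = deriv \<phi>2 m2"
      using m1 m2 by (simp_all add: d_def red1(2) red2(2))
    fix x
    have "\<bar>(exp (\<phi>1 (x - d)) - n1 (x - d)) - (exp (\<phi>2 x) - n2 x)\<bar>
      \<le> \<bar>exp (\<phi>1 (x - d)) - exp (\<phi>2 x)\<bar> + \<bar>n1 (x - d) - n2 x\<bar>" by arith
    also have "\<dots> \<le> (exp (\<Phi> v\<^sub>0) + 1 / v\<^sub>0\<^sup>2 / K) * \<bar>\<phi>1 (x - d) - \<phi>2 x\<bar>"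
      unfolding distrib_right by (intro add_mono exp_diff n_diff)
    finally have "\<bar>(exp (\<phi>1 (x - d)) - n1 (x - d)) - (exp (\<phi>2 x) - n2 x)\<bar> / \<epsilon>
      \<le> L * \<bar>\<phi>1 (x - d) - \<phi>2 x\<bar>"
      using \<epsilon> by (simp add: L_def divide_right_mono)
    then show "\<bar>(exp (\<phi>1 (x - d)) - n1 (x - d)) / \<epsilon> - (exp (\<phi>2 x) - n2 x) / \<epsilon>\<bar>
      \<le> L * \<bar>\<phi>1 (x - d) - \<phi>2 x\<bar>"
      using \<epsilon> by (simp add: diff_divide_distrib[symmetric])
  qed
  have "n2 x = n1 (x - d)" for x
  proof -
    have "K * \<bar>1 / n1 (x - d) - 1 / n2 x\<bar> \<le> 0"
      using v_diff[of "x - d" x] eq[of x] by simp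
    then have "1 / n1 (x - d) = 1 / n2 x"
      using \<open>K > 0\<close> by (simp add: mult_le_0_iff)
    then show ?thesis by simp
  qed
  then show ?thesis
    using eq red1(1) red2(1) by (intro exI[of _ d]) simp
qed

end

section \<open>Construction of the solitary wave\<close>

context traveling_wave
begin

text \<open>The slope \<open>dv/d\<xi>\<close> has a square-root zero at \<open>v\<^sub>0\<close>. The substitution \<open>v = v\<^sub>0 + s\<^sup>2\<close> turns
  the orbit into the regular equation \<open>ds/d\<xi> = speed s\<close> on \<open>\<bar>s\<bar> < s_max\<close>, the sign of \<open>s\<close>
  distinguishing the two sides of the crest; \<open>\<phi>' = - 2 s * slope s\<close> along it.\<close>

definition s_max :: real where
  "s_max = sqrt (1 - v\<^sub>0)"

text \<open>The simple zero of \<open>E\<close> at \<open>v\<^sub>0\<close> is divided out; the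
  value at \<open>h = 0\<close> is the derivative of \<open>E\<close> there, positive because
  \<open>k v\<^sub>0 < 0\<close>.\<close>

definition energy_quotient :: "real \<Rightarrow> real" where
  "energy_quotient h =
    (if h = 0 then (exp (\<Phi> v\<^sub>0) - 1 / v\<^sub>0) * \<Phi>' v\<^sub>0 else E (v\<^sub>0 + h) / h)"

definition slope :: "real \<Rightarrow> real" where
  "slope s = sqrt (energy_quotient (s\<^sup>2) / (2 * \<epsilon>))"

text \<open>From \<open>v = v\<^sub>0 + s\<^sup>2\<close> one has \<open>v' = 2 * s * s'\<close>,
  and \<phi>' is \<open>\<Phi>' v * v'\<close>; with \<open>\<phi>' = - 2 * s * slope s\<close> the
  factor \<open>2 * s\<close> cancels and this is \<open>s'\<close>. The factor
  \<open>2 * \<epsilon>\<close> in \<open>slope\<close> makes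
  \<open>\<epsilon> / 2 * \<phi>'\<^sup>2\<close> equal to the energy.\<close>

definition speed :: "real \<Rightarrow> real" where
  "speed s = slope s / (- \<Phi>' (v\<^sub>0 + s\<^sup>2))"

lemma s_max: "0 < s_max" "s_max\<^sup>2 = 1 - v\<^sub>0"
  using v\<^sub>0_less_1 by (simp_all add: s_max_def)

lemma s_square_less:
  assumes "\<bar>s\<bar> < s_max"
  shows "v\<^sub>0 + s\<^sup>2 < 1"
  using power_strict_mono[OF assms abs_ge_zero, of 2] s_max by simp

lemma energy_quotient_pos:
  assumes "0 \<le> h" "v\<^sub>0 + h < 1"
  shows "energy_quotient h > 0"
proof (cases "h = 0")
  case True
  then show ?thesis
    using k_v\<^sub>0 k_sign(2)[OF v\<^sub>0_pos] potential_deriv_neg[OF sonic_less_v\<^sub>0]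
    by (simp add: energy_quotient_def mult_neg_neg)
next
  case False
  then show ?thesis
    using assms energy_pos[of "v\<^sub>0 + h"] by (simp add: energy_quotient_def)
qed

lemma isCont_energy_quotient:
  assumes "0 \<le> h"
  shows "isCont energy_quotient h"
proof (cases "h = 0")
  case True
  have "((\<lambda>h. (E (v\<^sub>0 + h) - E v\<^sub>0) / h) \<longlongrightarrow> (exp (\<Phi> v\<^sub>0) - 1 / v\<^sub>0) * \<Phi>' v\<^sub>0) (at 0)"
    using energy_has_deriv[OF v\<^sub>0_pos] by (simp add: DERIV_def)
  then have "(energy_quotient \<longlongrightarrow> (exp (\<Phi> v\<^sub>0) - 1 / v\<^sub>0) * \<Phi>' v\<^sub>0) (at 0)"
    by (rule Lim_transform_eventually)
       (auto simp: energy_quotient_def energy_v\<^sub>0 eventually_at_filter)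
  then show ?thesis
    using True by (simp add: isCont_def energy_quotient_def)
next
  case False
  then have "h > 0" using assms by simp
  have "isCont E (v\<^sub>0 + h)"
    using v\<^sub>0_pos \<open>h > 0\<close> by (intro DERIV_isCont[OF energy_has_deriv]) simp
  then have "isCont (\<lambda>h. E (v\<^sub>0 + h)) h"
    by (rule isCont_o2[rotated]) (intro continuous_intros)
  then have "isCont (\<lambda>h. E (v\<^sub>0 + h) / h) h"
    using \<open>h > 0\<close> by (intro continuous_intros) auto
  moreover have "\<forall>\<^sub>F x in nhds h. energy_quotient x = E (v\<^sub>0 + x) / x"
    by (rule eventually_mono[OF eventually_nhds_in_open[of "{0<..}"]])
       (use \<open>h > 0\<close> in \<open>auto simp: energy_quotient_def\<close>)
  ultimately show ?thesis by (simp add: isCont_cong)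
qed

lemma slope_pos: "\<bar>s\<bar> < s_max \<Longrightarrow> slope s > 0"
  using energy_quotient_pos[of "s\<^sup>2"] s_square_less[of s] \<epsilon> by (simp add: slope_def)

lemma isCont_slope: "isCont slope s"
proof -
  have "isCont (\<lambda>s. energy_quotient (s\<^sup>2)) s"
    by (rule isCont_o2[OF _ isCont_energy_quotient]) (auto intro!: continuous_intros)
  then show ?thesis
    unfolding slope_def using \<epsilon> by (intro continuous_intros) auto
qed

lemma potential_deriv_orbit_neg: "\<Phi>' (v\<^sub>0 + s\<^sup>2) < 0"
proof (rule potential_deriv_neg)
  show "v\<^sub>s < v\<^sub>0 + s\<^sup>2"
    using sonic_less_v\<^sub>0 zero_le_power2[of s] by linarith
qed

lemma speed_pos: "\<bar>s\<bar> < s_max \<Longrightarrow> speed s > 0"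
  using slope_pos potential_deriv_orbit_neg by (simp add: speed_def divide_pos_neg)

lemma isCont_speed: "isCont speed s"
proof -
  have "v\<^sub>0 + s\<^sup>2 \<noteq> 0" using v\<^sub>0_pos by (smt (verit) zero_le_power2)
  then have "isCont (\<lambda>s. \<Phi>' (v\<^sub>0 + s\<^sup>2)) s"
    unfolding potential_deriv_def by (intro continuous_intros) auto
  then show ?thesis
    unfolding speed_def using potential_deriv_orbit_neg[of s]
    by (intro continuous_intros isCont_slope) auto
qed

text \<open>The square root of the quadratic bound on \<open>E\<close> is linear in
  \<open>1 - v\<close>, and \<open>1 - v = (s_max - s) * (s_max + s)\<close>. Restricting to
  \<open>s \<ge> s_max / 2\<close> keeps the division by \<open>s\<^sup>2\<close> harmless.\<close>

lemma speed_le: "\<exists>C. \<forall>s. s_max / 2 \<le> s \<and> s < s_max \<longrightarrow> speed s \<le> C * (s_max - s)"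
proof -
  obtain C where C: "\<And>v. v\<^sub>0 \<le> v \<Longrightarrow> v < 1 \<Longrightarrow> E v \<le> C * (1 - v)\<^sup>2"
    using energy_le_square by blast
  define B where "B = sqrt (\<bar>C\<bar> / (s_max / 2)\<^sup>2 / (2 * \<epsilon>))"
  define K where "K = - \<Phi>' v\<^sub>0"
  have "K > 0" using potential_deriv_neg[OF sonic_less_v\<^sub>0] by (simp add: K_def)
  have "speed s \<le> B * (2 * s_max) / K * (s_max - s)" if s: "s_max / 2 \<le> s" "s < s_max" for s
  proof -
    have "0 < s" "\<bar>s\<bar> < s_max" using s s_max by auto
    define w where "w = 1 - (v\<^sub>0 + s\<^sup>2)"
    have "w = (s_max - s) * (s_max + s)"
      using s_max(2) by (simp add: w_def algebra_simps power2_eq_square)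
    also have "\<dots> \<le> (s_max - s) * (2 * s_max)" using s by (intro mult_left_mono) auto
    finally have w: "w \<le> (s_max - s) * (2 * s_max)" .
    have "0 < w" using s_square_less[OF \<open>\<bar>s\<bar> < s_max\<close>] by (simp add: w_def)
    have "E (v\<^sub>0 + s\<^sup>2) \<le> C * w\<^sup>2"
      unfolding w_def using \<open>0 < w\<close> by (intro C) (auto simp: w_def)
    also have "\<dots> \<le> \<bar>C\<bar> * w\<^sup>2" by (intro mult_right_mono) auto
    finally have "energy_quotient (s\<^sup>2) \<le> \<bar>C\<bar> * w\<^sup>2 / s\<^sup>2"
      using \<open>0 < s\<close> by (simp add: energy_quotient_def divide_right_mono)
    also have "\<dots> \<le> \<bar>C\<bar> * w\<^sup>2 / (s_max / 2)\<^sup>2"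
      using s s_max \<open>0 < s\<close> by (intro divide_left_mono power_mono) auto
    finally have "slope s \<le> sqrt (\<bar>C\<bar> * w\<^sup>2 / (s_max / 2)\<^sup>2 / (2 * \<epsilon>))"
      unfolding slope_def using \<epsilon> by (intro real_sqrt_le_mono divide_right_mono) auto
    also have "\<dots> = B * w"
      using \<open>0 < w\<close> by (simp add: B_def real_sqrt_mult real_sqrt_divide)
    also have "\<dots> \<le> B * ((s_max - s) * (2 * s_max))"
      using w \<epsilon> by (intro mult_left_mono) (auto simp: B_def)
    finally have slope: "slope s \<le> B * ((s_max - s) * (2 * s_max))" .
    have "K \<le> - \<Phi>' (v\<^sub>0 + s\<^sup>2)"
      using potential_deriv_le[of "v\<^sub>0 + s\<^sup>2"] by (simp add: K_def)
    then have "speed s \<le> slope s / K"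
      unfolding speed_def using \<open>K > 0\<close> slope_pos[OF \<open>\<bar>s\<bar> < s_max\<close>]
      by (intro divide_left_mono mult_pos_pos) auto
    also have "\<dots> \<le> B * ((s_max - s) * (2 * s_max)) / K"
      using slope \<open>K > 0\<close> by (intro divide_right_mono) auto
    finally show ?thesis by (simp add: mult_ac)
  qed
  then show ?thesis by blast
qed

lemma slope_square:
  assumes "s \<noteq> 0" "\<bar>s\<bar> < s_max"
  shows "2 * \<epsilon> * (s * slope s)\<^sup>2 = E (v\<^sub>0 + s\<^sup>2)"
proof -
  have "(slope s)\<^sup>2 = energy_quotient (s\<^sup>2) / (2 * \<epsilon>)"
    unfolding slope_def
    using energy_quotient_pos[of "s\<^sup>2"] s_square_less[OF assms(2)] \<epsilon> by (intro real_sqrt_pow2) auto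
  then show ?thesis
    using assms(1) \<epsilon> by (simp add: power_mult_distrib energy_quotient_def)
qed

text \<open>After multiplication by \<open>speed s\<close> in the chain rule this is Poisson's
  equation. At \<open>s = 0\<close>, where the square root is not differentiated, the explicit
  factor \<open>s\<close> suffices: by Caratheodory's criterion continuity of \<open>slope\<close>
  makes the product differentiable. Elsewhere the product is a signed square root of the positive
  quantity \<open>2 * E / \<epsilon>\<close>.\<close>

lemma field_has_deriv:
  assumes s: "\<bar>s\<bar> < s_max"
  defines "v \<equiv> v\<^sub>0 + s\<^sup>2"
  shows "((\<lambda>s. - 2 * s * slope s) has_real_derivative (exp (\<Phi> v) - 1 / v) / \<epsilon> / speed s) (at s)"
proof (cases "s = 0")
  case True
  have "((\<lambda>s. - 2 * s * slope s) has_real_derivative - 2 * slope 0) (at 0)"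
    by (subst CARAT_DERIV) (auto intro!: exI[of _ "\<lambda>s. - 2 * slope s"] continuous_intros isCont_slope)
  moreover have "- 2 * slope 0 = (exp (\<Phi> v) - 1 / v) / \<epsilon> / speed 0"
  proof -
    have "(slope 0)\<^sup>2 = (exp (\<Phi> v\<^sub>0) - 1 / v\<^sub>0) * \<Phi>' v\<^sub>0 / (2 * \<epsilon>)"
      using energy_quotient_pos[of 0] v\<^sub>0_less_1 \<epsilon> by (simp add: slope_def energy_quotient_def)
    then show ?thesis
      using slope_pos[of 0] s_max(1) potential_deriv_orbit_neg[of 0] \<epsilon>
      by (simp add: True v_def speed_def field_simps power2_eq_square)
  qed
  ultimately show ?thesis using True by simp
next
  case False
  have "v > 0" using v\<^sub>0_pos by (simp add: v_def add_pos_nonneg)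
  have E_pos: "E v > 0"
    using False energy_pos[of v] s_square_less[OF s] by (simp add: v_def)
  have root: "sqrt (2 * E (v\<^sub>0 + t\<^sup>2) / \<epsilon>) = 2 * \<bar>t\<bar> * slope t" if "t \<noteq> 0" "\<bar>t\<bar> < s_max" for t
  proof -
    have "2 * E (v\<^sub>0 + t\<^sup>2) / \<epsilon> = (2 * t * slope t)\<^sup>2"
      using slope_square[OF that] \<epsilon> by (simp add: field_simps power2_eq_square)
    then show ?thesis using slope_pos[OF that(2)] by (simp add: abs_mult)
  qed
  have inner: "((\<lambda>t. v\<^sub>0 + t\<^sup>2) has_real_derivative 2 * s) (at s)"
    by (auto intro!: derivative_eq_intros)
  have E_v: "((\<lambda>t. E (v\<^sub>0 + t\<^sup>2)) has_real_derivative ((exp (\<Phi> v) - 1 / v) * \<Phi>' v) * (2 * s)) (at s)"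
    unfolding v_def by (rule DERIV_chain2[OF energy_has_deriv inner]) (use \<open>v > 0\<close> in \<open>simp add: v_def\<close>)
  have "((\<lambda>t. - sgn s * sqrt (2 * E (v\<^sub>0 + t\<^sup>2) / \<epsilon>)) has_real_derivative
      - sgn s * (inverse (sqrt (2 * E v / \<epsilon>)) / 2 * (2 * (((exp (\<Phi> v) - 1 / v) * \<Phi>' v) * (2 * s)) / \<epsilon>))) (at s)"
  proof -
    have "2 * E (v\<^sub>0 + s\<^sup>2) / \<epsilon> > 0" using E_pos \<epsilon> by (simp add: v_def)
    then have "(sqrt has_real_derivative inverse (sqrt (2 * E (v\<^sub>0 + s\<^sup>2) / \<epsilon>)) / 2)
        (at (2 * E (v\<^sub>0 + s\<^sup>2) / \<epsilon>))"
      by (rule DERIV_real_sqrt)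
    from DERIV_cmult[OF DERIV_chain2[OF this DERIV_cdivide[OF DERIV_cmult[OF E_v]]]]
    show ?thesis unfolding v_def .
  qed
  also have "- sgn s * (inverse (sqrt (2 * E v / \<epsilon>)) / 2 * (2 * (((exp (\<Phi> v) - 1 / v) * \<Phi>' v) * (2 * s)) / \<epsilon>))
    = (exp (\<Phi> v) - 1 / v) / \<epsilon> / speed s"
    using root[OF False s] False slope_pos[OF s] \<epsilon> potential_deriv_orbit_neg[of s]
    unfolding speed_def v_def
    by (simp add: field_simps sgn_if abs_if)
  finally have "((\<lambda>t. - sgn s * sqrt (2 * E (v\<^sub>0 + t\<^sup>2) / \<epsilon>)) has_real_derivative
    (exp (\<Phi> v) - 1 / v) / \<epsilon> / speed s) (at s)" .
  \<comment> \<open>The radius keeps \<open>t\<close> on the same side of 0 as \<open>s\<close> and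
    inside the orbit, where the signed root agrees with the field.\<close>
  then show ?thesis
  proof (rule has_field_derivative_transform_within[where d = "min \<bar>s\<bar> (s_max - \<bar>s\<bar>)"])
    fix t assume "dist t s < min \<bar>s\<bar> (s_max - \<bar>s\<bar>)"
    then have "t \<noteq> 0" "\<bar>t\<bar> < s_max" "sgn t = sgn s"
      by (auto simp: dist_real_def sgn_if)
    with root[of t] show "- sgn s * sqrt (2 * E (v\<^sub>0 + t\<^sup>2) / \<epsilon>) = - 2 * t * slope t"
      by (simp add: sgn_if abs_if split: if_splits)
  qed (use False s in auto)
qed

text \<open>The orbit is exported as a system for \<open>v\<close> and \<open>\<psi>\<close>, the
  latter being \<phi>'. Its right sides no longer contain \<open>slope\<close> and are smooth for
  \<open>v \<ge> v\<^sub>0\<close>, so regularity can be bootstrapped from it although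
  \<open>speed\<close> is only shown to be continuous.\<close>

lemma solitary_wave_exists:
  obtains v \<psi> where "\<And>x. v\<^sub>0 \<le> v x" "\<And>x. v x < 1" "v 0 = v\<^sub>0" "\<And>x. v (- x) = v x"
    "(v \<longlongrightarrow> 1) at_infinity" "\<And>x. (v has_real_derivative \<psi> x / \<Phi>' (v x)) (at x)"
    "\<And>x. (\<psi> has_real_derivative (exp (\<Phi> (v x)) - 1 / v x) / \<epsilon>) (at x)"
    "\<And>x. x > 0 \<Longrightarrow> \<psi> x < 0"
proof -
  obtain C where C: "\<And>s. s_max / 2 \<le> s \<Longrightarrow> s < s_max \<Longrightarrow> speed s \<le> C * (s_max - s)"
    using speed_le by blast
  have even: "speed (- s) = speed s" for s by (simp add: speed_def slope_def)
  obtain y where y: "y 0 = 0" "\<And>x. y (- x) = - y x" "\<And>x. \<bar>y x\<bar> < s_max"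
    "\<And>x. (y has_real_derivative speed (y x)) (at x)" "(y \<longlongrightarrow> s_max) at_top"
  proof (rule autonomous_ode_exists[of s_max speed "s_max / 2" C])
  qed (use s_max(1) isCont_speed speed_pos even C in auto)
  define v where "v x = v\<^sub>0 + (y x)\<^sup>2" for x
  define \<psi> where "\<psi> x = - 2 * y x * slope (y x)" for x
  show thesis
  proof
    show "v\<^sub>0 \<le> v x" "v x < 1" for x
      using s_square_less[OF y(3)[of x]] by (auto simp: v_def)
    show "v 0 = v\<^sub>0" "v (- x) = v x" for x by (simp_all add: v_def y)
    have "(v \<longlongrightarrow> v\<^sub>0 + s_max\<^sup>2) at_top" unfolding v_def by (intro tendsto_intros y)
    then have top: "(v \<longlongrightarrow> 1) at_top" by (simp add: s_max)
    moreover have "(\<lambda>x. v (- x)) = v" by (simp add: v_def y fun_eq_iff)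
    ultimately have "(v \<longlongrightarrow> 1) at_bot" by (simp add: filterlim_at_bot_mirror)
    with top show "(v \<longlongrightarrow> 1) at_infinity"
      by (simp add: at_infinity_eq_at_top_bot filterlim_sup)
    show "(v has_real_derivative \<psi> x / \<Phi>' (v x)) (at x)" for x
    proof -
      have "(v has_real_derivative 2 * y x * speed (y x)) (at x)"
        unfolding v_def by (auto intro!: derivative_eq_intros y)
      then show ?thesis by (simp add: \<psi>_def v_def speed_def)
    qed
    show "(\<psi> has_real_derivative (exp (\<Phi> (v x)) - 1 / v x) / \<epsilon>) (at x)" for x
      using DERIV_chain2[OF field_has_deriv[OF y(3)] y(4), of x] speed_pos[OF y(3)[of x]]
      by (simp add: \<psi>_def[abs_def] v_def)
    show "\<psi> x < 0" if "x > 0" for x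
    proof -
      have "y 0 < y x"
      proof (rule DERIV_pos_imp_increasing[OF that])
        show "\<exists>d. (y has_real_derivative d) (at t) \<and> 0 < d" for t
          using y(4)[of t] speed_pos[OF y(3)[of t]] by blast
      qed
      then show ?thesis using slope_pos[OF y(3)[of x]] by (simp add: \<psi>_def y)
    qed
  qed
qed

text \<open>Along the orbit, \<open>v, \<phi>', exp \<phi>, n, 1 / \<Phi>' v, \<phi>\<close> have derivatives that are polynomials in
  each other.\<close>

lemma smooth_orbit:
  assumes v: "\<And>x. v\<^sub>0 \<le> v x" "\<And>x. (v has_real_derivative \<psi> x / \<Phi>' (v x)) (at x)"
    and \<psi>: "\<And>x. (\<psi> has_real_derivative (exp (\<Phi> (v x)) - 1 / v x) / \<epsilon>) (at x)"
  shows "smooth_fun (\<lambda>x. 1 / v x)" "smooth_fun (\<lambda>x. c * (1 - v x))" "smooth_fun (\<lambda>x. \<Phi> (v x))"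
proof -
  have v_pos: "v x > 0" for x using v(1)[of x] v\<^sub>0_pos by simp
  have d_neg: "\<Phi>' (v x) < 0" for x
    using v(1)[of x] sonic_less_v\<^sub>0 by (intro potential_deriv_neg) simp
  define e where "e x = exp (\<Phi> (v x))" for x
  define n where "n x = 1 / v x" for x
  define q where "q x = 1 / \<Phi>' (v x)" for x
  define \<phi> where "\<phi> x = \<Phi> (v x)" for x
  define G where "G = {v, \<psi>, e, n, q, \<phi>}"
  have gens: "v \<in> fun_algebra G" "\<psi> \<in> fun_algebra G" "e \<in> fun_algebra G" "n \<in> fun_algebra G"
    "q \<in> fun_algebra G" "\<phi> \<in> fun_algebra G"
    by (auto simp: G_def intro: fun_algebra.gen)
  note alg = fun_algebra.const fun_algebra.add fun_algebra.mult gens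
  have \<phi>: "(\<phi> has_real_derivative \<psi> x) (at x)" for x
    using DERIV_chain2[OF potential_has_deriv[of _ \<sigma> c, OF v_pos] v(2), of x] d_neg[of x]
    by (simp add: \<phi>_def[abs_def])
  \<comment> \<open>Differences and quotients are written with the factors \<open>- 1\<close>,
    \<open>1 / \<epsilon>\<close>, \<open>n\<close> and \<open>q\<close> because
    \<open>fun_algebra\<close> is generated by constants, sums and products only.\<close>
  have derivs: "(v has_real_derivative \<psi> x * q x) (at x)"
    "(\<psi> has_real_derivative (e x + (- 1) * n x) * (1 / \<epsilon>)) (at x)"
    "(e has_real_derivative e x * \<psi> x) (at x)"
    "(n has_real_derivative (- 1) * (n x * n x * (\<psi> x * q x))) (at x)"
    "(q has_real_derivative q x * q x * ((\<sigma> * (n x * n x) + c\<^sup>2) * (\<psi> x * q x))) (at x)" for x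
  proof -
    show v': "(v has_real_derivative \<psi> x * q x) (at x)"
      using v(2)[of x] by (simp add: q_def)
    show "(\<psi> has_real_derivative (e x + (- 1) * n x) * (1 / \<epsilon>)) (at x)"
      using \<psi>[of x] by (simp add: e_def n_def)
    show "(e has_real_derivative e x * \<psi> x) (at x)"
      using DERIV_chain2[OF DERIV_exp \<phi>, of x] by (simp add: e_def[abs_def] \<phi>_def[abs_def])
    show "(n has_real_derivative (- 1) * (n x * n x * (\<psi> x * q x))) (at x)"
      unfolding n_def using v_pos[of x]
      by (auto intro!: derivative_eq_intros v')
    have "((\<lambda>x. \<Phi>' (v x)) has_real_derivative - ((\<sigma> * (n x * n x) + c\<^sup>2) * (\<psi> x * q x))) (at x)"
      unfolding potential_deriv_def using v_pos[of x]
      by (auto intro!: derivative_eq_intros v' simp: n_def algebra_simps)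
    from DERIV_inverse_fun[OF this] d_neg[of x]
    show "(q has_real_derivative q x * q x * ((\<sigma> * (n x * n x) + c\<^sup>2) * (\<psi> x * q x))) (at x)"
      by (simp add: q_def[abs_def] inverse_eq_divide mult_ac)
  qed
  have closed: "\<exists>g' \<in> fun_algebra G. \<forall>x. (g has_real_derivative g' x) (at x)" if "g \<in> G" for g
  proof -
    have 1: "\<exists>g' \<in> fun_algebra G. \<forall>x. (v has_real_derivative g' x) (at x)"
      by (rule bexI, rule allI, rule derivs(1)) (intro alg)
    have 2: "\<exists>g' \<in> fun_algebra G. \<forall>x. (\<psi> has_real_derivative g' x) (at x)"
      by (rule bexI, rule allI, rule derivs(2)) (intro alg)
    have 3: "\<exists>g' \<in> fun_algebra G. \<forall>x. (e has_real_derivative g' x) (at x)"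
      by (rule bexI, rule allI, rule derivs(3)) (intro alg)
    have 4: "\<exists>g' \<in> fun_algebra G. \<forall>x. (n has_real_derivative g' x) (at x)"
      by (rule bexI, rule allI, rule derivs(4)) (intro alg)
    have 5: "\<exists>g' \<in> fun_algebra G. \<forall>x. (q has_real_derivative g' x) (at x)"
      by (rule bexI, rule allI, rule derivs(5)) (intro alg)
    have 6: "\<exists>g' \<in> fun_algebra G. \<forall>x. (\<phi> has_real_derivative g' x) (at x)"
      by (rule bexI, rule allI, rule \<phi>) (intro alg)
    from that show ?thesis
      unfolding G_def by (elim insertE emptyE; simp only: 1 2 3 4 5 6 G_def[symmetric])
  qed
  have "smooth_fun n" "smooth_fun \<phi>"
    by (intro smooth_fun_algebra[OF closed] gens; assumption)+
  then show "smooth_fun (\<lambda>x. 1 / v x)" "smooth_fun (\<lambda>x. \<Phi> (v x))"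
    by (simp_all add: n_def[abs_def] \<phi>_def[abs_def])
  have "(\<lambda>x. c * (1 + (- 1) * v x)) \<in> fun_algebra G"
    by (intro alg)
  from smooth_fun_algebra[OF closed this] show "smooth_fun (\<lambda>x. c * (1 - v x))"
    by simp
qed

lemma solitary_wave:
  obtains n u \<phi> where "tw_solution \<sigma> c \<epsilon> n u \<phi>" "nontrivial n u \<phi>"
    "\<And>x. n x = n (- x) \<and> u x = u (- x) \<and> \<phi> x = \<phi> (- x)"
    "\<And>x. x > 0 \<Longrightarrow> deriv n x < 0 \<and> deriv u x < 0 \<and> deriv \<phi> x < 0"
    "\<And>x. n x \<le> n 0 \<and> u x \<le> u 0 \<and> \<phi> x \<le> \<phi> 0"
    "\<And>x. n x > 1 \<and> u x > 0 \<and> \<phi> x > 0"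
proof -
  obtain v \<psi> where v: "\<And>x. v\<^sub>0 \<le> v x" "\<And>x. v x < 1" "v 0 = v\<^sub>0" "\<And>x. v (- x) = v x"
    and lim: "(v \<longlongrightarrow> 1) at_infinity"
    and v': "\<And>x. (v has_real_derivative \<psi> x / \<Phi>' (v x)) (at x)"
    and \<psi>: "\<And>x. (\<psi> has_real_derivative (exp (\<Phi> (v x)) - 1 / v x) / \<epsilon>) (at x)"
    and \<psi>_neg: "\<And>x. x > 0 \<Longrightarrow> \<psi> x < 0"
    using solitary_wave_exists by blast
  have v_pos: "v x > 0" for x using v(1)[of x] v\<^sub>0_pos by simp
  have v_sonic: "v\<^sub>s < v x" for x using v(1)[of x] sonic_less_v\<^sub>0 by simp
  have d_neg: "\<Phi>' (v x) < 0" for x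
    by (rule potential_deriv_neg[OF v_sonic])
  define n where "n x = 1 / v x" for x
  define u where "u x = c * (1 - v x)" for x
  define \<phi> where "\<phi> x = \<Phi> (v x)" for x
  define w where "w x = \<psi> x / \<Phi>' (v x)" for x
  have v_w: "(v has_real_derivative w x) (at x)" for x
    unfolding w_def by (rule v')
  have n': "(n has_real_derivative - w x / (v x)\<^sup>2) (at x)" for x
    unfolding n_def using v_pos[of x]
    by (auto intro!: derivative_eq_intros v_w simp: power2_eq_square)
  have u': "(u has_real_derivative - c * w x) (at x)" for x
    unfolding u_def by (auto intro!: derivative_eq_intros v_w)
  have \<phi>': "(\<phi> has_real_derivative \<psi> x) (at x)" for x
    using DERIV_chain2[OF potential_has_deriv[of _ \<sigma> c, OF v_pos] v', of x] d_neg[of x]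
    by (simp add: \<phi>_def[abs_def])
  have deriv_n: "deriv n x = - w x / (v x)\<^sup>2" and deriv_u: "deriv u x = - c * w x" for x
    using n' u' by (auto intro: DERIV_imp_deriv)
  have deriv_\<phi>: "deriv \<phi> = \<psi>"
    using \<phi>' by (auto intro: DERIV_imp_deriv)
  have tw: "tw_solution \<sigma> c \<epsilon> n u \<phi>"
    unfolding tw_solution_def
  proof (intro conjI allI)
    show "smooth_fun n" "smooth_fun u" "smooth_fun \<phi>"
      unfolding n_def u_def \<phi>_def using smooth_orbit[OF v(1) v' \<psi>] by auto
    show "n x > 0" for x using v_pos by (simp add: n_def)
    show "- c * deriv n x + deriv (\<lambda>y. n y * u y) x = 0" for x
    proof -
      have "(\<lambda>y. n y * u y) = (\<lambda>y. c * n y - c)"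
      proof
        show "n y * u y = c * n y - c" for y
          using v_pos[of y] by (simp add: n_def u_def field_simps)
      qed
      moreover have "((\<lambda>y. c * n y - c) has_real_derivative c * deriv n x) (at x)"
        unfolding deriv_n by (auto intro!: derivative_eq_intros n')
      ultimately show ?thesis by (simp add: DERIV_imp_deriv)
    qed
    show "- c * deriv u x + u x * deriv u x + \<sigma> * deriv n x / n x = - deriv \<phi> x" for x
    proof -
      have "\<psi> x = \<Phi>' (v x) * w x" using d_neg[of x] by (simp add: w_def)
      then show ?thesis
        using v_pos[of x] unfolding deriv_n deriv_u deriv_\<phi> n_def u_def potential_deriv_def
        by (simp add: field_simps power2_eq_square)
    qed
    show "\<epsilon> * deriv (deriv \<phi>) x = exp (\<phi> x) - n x" for x
      unfolding deriv_\<phi> using DERIV_imp_deriv[OF \<psi>] \<epsilon> by (simp add: \<phi>_def n_def)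
    have "(n \<longlongrightarrow> 1 / 1) at_infinity" "(u \<longlongrightarrow> c * (1 - 1)) at_infinity"
      unfolding n_def u_def by (intro tendsto_intros lim; simp)+
    then show "(n \<longlongrightarrow> 1) at_infinity" "(u \<longlongrightarrow> 0) at_infinity" by simp_all
    show "(\<phi> \<longlongrightarrow> 0) at_infinity"
      using isCont_tendsto_compose[OF DERIV_isCont[OF potential_has_deriv] lim]
      by (simp add: \<phi>_def[abs_def])
  qed
  show thesis
  proof (rule that[OF tw])
    show pos: "n x > 1 \<and> u x > 0 \<and> \<phi> x > 0" for x
      using v_pos[of x] v(2)[of x] c potential_strict_antimono[OF v_sonic v(2), of x]
      by (simp add: n_def u_def \<phi>_def)
    show "nontrivial n u \<phi>"
      unfolding nontrivial_def using pos by (metis less_irrefl)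
    show "n x = n (- x) \<and> u x = u (- x) \<and> \<phi> x = \<phi> (- x)" for x
      by (simp add: n_def u_def \<phi>_def v)
    show "deriv n x < 0 \<and> deriv u x < 0 \<and> deriv \<phi> x < 0" if "x > 0" for x
    proof -
      have "w x > 0" using \<psi>_neg[OF that] d_neg[of x] by (simp add: w_def divide_neg_neg)
      then show ?thesis
        using \<psi>_neg[OF that] v_pos[of x] c by (simp add: deriv_n deriv_u deriv_\<phi>)
    qed
    show "n x \<le> n 0 \<and> u x \<le> u 0 \<and> \<phi> x \<le> \<phi> 0" for x
    proof (cases "v x = v\<^sub>0")
      case False
      then have "v\<^sub>0 < v x" using v(1)[of x] by simp
      then show ?thesis
        using potential_strict_antimono[OF sonic_less_v\<^sub>0, of "v x"] v\<^sub>0_pos c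
        by (simp add: n_def u_def \<phi>_def v(3) frac_le)
    qed (simp add: n_def u_def \<phi>_def v(3))
  qed
qed

end

theorem theorem1p1:
  fixes \<sigma> V \<gamma> \<epsilon> :: real
  assumes "\<sigma> \<ge> 0" and "V > 0" and "\<gamma> > 0" and "\<epsilon> > 0"
    and "\<sigma> > 0 \<Longrightarrow> sqrt ((1 + \<sigma>) / \<sigma>) < (V + \<gamma> * \<epsilon>) / sqrt \<sigma> \<and>
                     (V + \<gamma> * \<epsilon>) / sqrt \<sigma> < zeta \<sigma>"
    and "\<sigma> = 0 \<Longrightarrow> 1 < V + \<gamma> * \<epsilon> \<and> V + \<gamma> * \<epsilon> < zeta 0"
  shows "\<exists>n u \<phi>.
     tw_solution \<sigma> (V + \<gamma> * \<epsilon>) \<epsilon> n u \<phi> \<and> nontrivial n u \<phi> \<and>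
     (\<forall>n2 u2 \<phi>2. tw_solution \<sigma> (V + \<gamma> * \<epsilon>) \<epsilon> n2 u2 \<phi>2 \<and> nontrivial n2 u2 \<phi>2 \<longrightarrow>
        (\<exists>xc. \<forall>x. n2 x = n (x - xc) \<and> u2 x = u (x - xc) \<and> \<phi>2 x = \<phi> (x - xc))) \<and>
     (\<forall>x. n x = n (- x) \<and> u x = u (- x) \<and> \<phi> x = \<phi> (- x)) \<and>
     (\<forall>x > 0. deriv n x < 0 \<and> deriv u x < 0 \<and> deriv \<phi> x < 0) \<and>
     (\<forall>x. n x \<le> n 0 \<and> u x \<le> u 0 \<and> \<phi> x \<le> \<phi> 0) \<and>
     (\<forall>x. n x > 1 \<and> u x > 0 \<and> \<phi> x > 0)"
proof -
  define c where "c = V + \<gamma> * \<epsilon>"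
  have "c > 0" using assms by (simp add: c_def add_pos_pos)
  have "1 + \<sigma> < c\<^sup>2"
  proof (cases "\<sigma> = 0")
    case True
    then show ?thesis using assms(6) by (simp add: c_def one_less_power)
  next
    case False
    then have "sqrt ((1 + \<sigma>) / \<sigma>) * sqrt \<sigma> < c"
      using assms(1,5) by (simp add: c_def pos_less_divide_eq)
    then have "sqrt (1 + \<sigma>) < c"
      using False by (simp add: real_sqrt_mult[symmetric])
    then show ?thesis
      using power_strict_mono[of "sqrt (1 + \<sigma>)" c 2] \<open>\<sigma> \<ge> 0\<close> by simp
  qed
  moreover have "energy \<sigma> c (sqrt \<sigma> / c) < 0"
    using assms \<open>c > 0\<close> unfolding c_def by (intro energy_sonic_neg)
  ultimately interpret traveling_wave \<sigma> c \<epsilon>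
    using assms \<open>c > 0\<close> by unfold_locales
  obtain n u \<phi> where "tw_solution \<sigma> c \<epsilon> n u \<phi>" "nontrivial n u \<phi>"
    "\<And>x. n x = n (- x) \<and> u x = u (- x) \<and> \<phi> x = \<phi> (- x)"
    "\<And>x. x > 0 \<Longrightarrow> deriv n x < 0 \<and> deriv u x < 0 \<and> deriv \<phi> x < 0"
    "\<And>x. n x \<le> n 0 \<and> u x \<le> u 0 \<and> \<phi> x \<le> \<phi> 0"
    "\<And>x. n x > 1 \<and> u x > 0 \<and> \<phi> x > 0"
    using solitary_wave by blast
  then show ?thesis
    unfolding c_def[symmetric]
    by (intro exI[of _ n] exI[of _ u] exI[of _ \<phi>] conjI allI impI solution_unique) auto
qed

end
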